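(* Let $A,B\in\mathbf{P}_n$ and let $p\ge 2$ be a real number. (i) For every $C\in\mathbf{P}_n$, $$\frac{\delta_p(A,C)^p+\delta_p(B,C)^p}{2}\ \ge\ 2^{-p}\,\delta_p(A,B)^p+\delta_p(A\#B,C)^p .$$ (ii) In the case $C=I$, $$\frac{\delta_p(A,I)^p+\delta_p(B,I)^p}{2}\ \ge\ 2^{-p}\,\delta_p(A,B)^p+\delta_p(A\#B,I)^p .$$ (iii) In particular, if $A,B\in E_p$, then $$1-\delta_p(A\#B,I)^p\ \ge\ 2^{-p}\,\delta_p(A,B)^p .$$ (iv) The inequality in (i) is strict unless $A,B,C$ $\Gamma$-commute, and the inequalities in (ii) and (iii) are strict unless $A$ and $B$ commute.
   Context: $\mathbf{P}_n=\mathbf{P}_{n\times n}(\mathbb{C})$ denotes the set of $n\times n$ complex positive definite (Hermitian) matrices, $I$ the identity matrix, and $[A,B]=AB-BA$. For $1<p<\infty$, $\|X\|_p=(\operatorname{Tr}|X|^p)^{1/p}$ is the Schatten $p$-norm. The distance $\delta_p$ on $\mathbf{P}_n$ is $$\delta_p(A,B)=\left\|\log\left(A^{-1/2}BA^{-1/2}\right)\right\|_p ,$$ which is the geodesic distance, i.e. the infimum of $\int_0^1\|\gamma(t)^{-1/2}\gamma'(t)\gamma(t)^{-1/2}\|_p\,dt$ over smooth curves $\gamma:[0,1]\to\mathbf{P}_n$ with $\gamma(0)=A$, $\gamma(1)=B$. The matrix geometric mean (the geodesic midpoint) is $$A\#B=A^{1/2}\left(A^{-1/2}BA^{-1/2}\right)^{1/2}A^{1/2}.$$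 The exponential unit sphere is $E_p=\{U\in\mathbf{P}_n:\ \delta_p(U,I)=1\}$. Matrices $A,B,C\in\mathbf{P}_n$ are said to $\Gamma$-commute if there exists an invertible $X\in M_{n\times n}(\mathbb{C})$ such that $XAX^*$, $XBX^*$, $XCX^*$ all commute with one another; equivalently, $AB^{-1}C=CB^{-1}A$; equivalently, $[A^{-1/2}BA^{-1/2},A^{-1/2}CA^{-1/2}]=0$. *)

theory Defs
  imports "HOL-Analysis.Analysis"
begin

definition hconj :: "complex^'n^'m \<Rightarrow> complex^'m^'n" where
  "hconj A = (\<chi> i j. cnj (A $ j $ i))"

definition hermitian :: "complex^'n^'n \<Rightarrow> bool" where
  "hermitian A \<longleftrightarrow> hconj A = A"

definition unitary :: "complex^'n^'n \<Rightarrow> bool" where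
  "unitary U \<longleftrightarrow> hconj U ** U = mat 1 \<and> U ** hconj U = mat 1"

definition diag_real :: "('n \<Rightarrow> real) \<Rightarrow> complex^'n^'n" where
  "diag_real d = (\<chi> i j. if i = j then complex_of_real (d i) else 0)"

(* For Hermitian A the quadratic form is real, so taking Re discards nothing. *)
definition posdef :: "(complex^'n^'n) set" where
  "posdef = {A. hermitian A \<and>
     (\<forall>x. x \<noteq> 0 \<longrightarrow> Re (\<Sum>i\<in>UNIV. \<Sum>j\<in>UNIV. cnj (x $ i) * A $ i $ j * x $ j) > 0)}"

(* Spectral functional calculus.  It is meant for Hermitian A, where a unitary
   diagonalisation exists and the value does not depend on the choice of one;
   THE is unspecified for arguments that have no such diagonalisation. *)
definition matfun :: "(real \<Rightarrow> real) \<Rightarrow> complex^'n^'n \<Rightarrow> complex^'n^'n" where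
  "matfun f A = (THE F. \<exists>U d. unitary U \<and> A = U ** diag_real d ** hconj U \<and>
                              F = U ** diag_real (\<lambda>i. f (d i)) ** hconj U)"

(* Real powers and the logarithm, for positive definite A.  For t > 0 the power is also
   the intended one for positive semidefinite A, because 0 powr t = 0. *)
definition matpow :: "complex^'n^'n \<Rightarrow> real \<Rightarrow> complex^'n^'n" where
  "matpow A t = matfun (\<lambda>x. x powr t) A"

definition matlog :: "complex^'n^'n \<Rightarrow> complex^'n^'n" where
  "matlog A = matfun ln A"

definition matabs :: "complex^'n^'n \<Rightarrow> complex^'n^'n" where
  "matabs X = matpow (hconj X ** X) (1/2)"

(* The trace below is that of a positive semidefinite matrix, hence real. *)
definition schatten_norm :: "real \<Rightarrow> complex^'n^'n \<Rightarrow> real" where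
  "schatten_norm p X = (Re (trace (matpow (matabs X) p))) powr (1/p)"

definition pd_dist :: "real \<Rightarrow> complex^'n^'n \<Rightarrow> complex^'n^'n \<Rightarrow> real" where
  "pd_dist p A B = schatten_norm p (matlog (matpow A (-1/2) ** B ** matpow A (-1/2)))"

definition geom_mean :: "complex^'n^'n \<Rightarrow> complex^'n^'n \<Rightarrow> complex^'n^'n" where
  "geom_mean A B =
     matpow A (1/2) ** matpow (matpow A (-1/2) ** B ** matpow A (-1/2)) (1/2) ** matpow A (1/2)"

definition exp_unit_sphere :: "real \<Rightarrow> (complex^'n^'n) set" where
  "exp_unit_sphere p = {U \<in> posdef. pd_dist p U (mat 1) = 1}"

definition mat_commute :: "complex^'n^'n \<Rightarrow> complex^'n^'n \<Rightarrow> bool" where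
  "mat_commute A B \<longleftrightarrow> A ** B = B ** A"

definition Gamma_commute :: "complex^'n^'n \<Rightarrow> complex^'n^'n \<Rightarrow> complex^'n^'n \<Rightarrow> bool" where
  "Gamma_commute A B C \<longleftrightarrow> (\<exists>X :: complex^'n^'n. invertible X \<and>
     mat_commute (X ** A ** hconj X) (X ** B ** hconj X) \<and>
     mat_commute (X ** A ** hconj X) (X ** C ** hconj X) \<and>
     mat_commute (X ** B ** hconj X) (X ** C ** hconj X))"

end

theory Submission
  imports Defs
begin

text \<open>
  Distance and geometric mean are invariant under congruence, so \<open>A # B\<close> may be moved to the identity.
  Then \<open>A = exp (- X)\<close>, \<open>B = exp X\<close>, \<open>C = exp Y\<close> with Hermitian \<open>X\<close>, \<open>Y\<close>, and \<open>\<delta>(A, B) = 2 \<parallel>X\<parallel>\<close>,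
  \<open>\<delta>(A # B, C) = \<parallel>Y\<parallel>\<close>.  The inequality is the sum of two facts.

  \<^item> The exponential map increases distances: \<open>\<delta>(exp X, exp Y) \<ge> \<parallel>Y - X\<parallel>\<close>, strictly if the two
    exponentials do not commute (\<open>exp_metric_increasing\<close>, \<open>exp_metric_increasing_strict\<close>).

  \<^item> For Hermitian matrices and \<open>p \<ge> 2\<close> Clarkson's inequality
    \<open>\<parallel>Y + X\<parallel>^p + \<parallel>Y - X\<parallel>^p \<ge> 2 (\<parallel>X\<parallel>^p + \<parallel>Y\<parallel>^p)\<close> holds (\<open>clarkson_hermitian\<close>).

  The first, applied to \<open>(A, C)\<close> and \<open>(B, C)\<close>, bounds the two distances to \<open>C\<close> below by \<open>\<parallel>Y + X\<parallel>\<close> and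
  \<open>\<parallel>Y - X\<parallel>\<close>, and the second bounds those.  If the result is an equality, then \<open>exp (- X)\<close> commutes with
  \<open>exp Y\<close>, so \<open>A\<close>, \<open>B\<close>, \<open>C\<close> commute with one another after one congruence.

  For the first fact it suffices that squaring at least doubles distances (\<open>pd_dist_square\<close>): then
  \<open>2^k \<delta>(exp (X / 2^k), exp (Y / 2^k))\<close> is at most \<open>\<delta>(exp X, exp Y)\<close> for all \<open>k\<close>, and in the limit
  it dominates \<open>\<parallel>Y - X\<parallel>\<close>.  For positive definite \<open>P\<close>, \<open>Q\<close> and \<open>T = Q P^{-1}\<close>, the doubling says
  that the eigenvalues of \<open>T\<close>, which are positive, are log-majorised by its singular values, in the
  form needed for the power \<open>p\<close> (\<open>weyl_power_inequality\<close>).  This follows from Klein's trace inequality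
  once the diagonal of \<open>log (hconj T ** T)\<close>, in an orthonormal basis adapted to the eigenvectors of
  \<open>T\<close>, is compared with the determinants of the restrictions of \<open>T\<close> to its invariant subspaces
  (\<open>compressed_log_trace_le\<close>).  Equality in Klein's inequality forces the squares of the eigenvalues and
  of the singular values of \<open>T\<close> to have the same sum, which makes \<open>T\<close> Hermitian, so that \<open>P\<close> and \<open>Q\<close>
  commute; this is where strictness comes from.
\<close>


section \<open>Hermitian conjugation and real diagonal matrices\<close>

lemma matrix_add_rdistrib: "(A + B) ** C = A ** C + B ** (C :: 'a::semiring_1^'p^'n)"
  by (vector matrix_matrix_mult_def sum.distrib[symmetric] distrib_right)

lemma matrix_diff_ldistrib: "A ** (B - C) = A ** B - A ** (C :: 'a::ring_1^'p^'n)"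
  by (vector matrix_matrix_mult_def sum_subtractf[symmetric] right_diff_distrib)

lemma matrix_diff_rdistrib: "(A - B) ** C = A ** C - B ** (C :: 'a::ring_1^'p^'n)"
  by (vector matrix_matrix_mult_def sum_subtractf[symmetric] left_diff_distrib)

lemmas matrix_distribs =
  matrix_add_ldistrib matrix_add_rdistrib matrix_diff_ldistrib matrix_diff_rdistrib

lemma matrix_mult_cancel_mid:
  fixes A B C D :: "complex^'n^'n"
  assumes "B ** C = mat 1"
  shows "(A ** B) ** (C ** D) = A ** D"
proof -
  have "(A ** B) ** (C ** D) = A ** ((B ** C) ** D)" by (simp only: matrix_mul_assoc)
  then show ?thesis by (simp add: assms)
qed

lemma hconj_nth [simp]: "hconj A $ i $ j = cnj (A $ j $ i)"
  by (simp add: hconj_def)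

lemma hconj_mult: "hconj (A ** B) = hconj B ** hconj A"
  by (simp add: vec_eq_iff matrix_matrix_mult_def mult.commute)

lemma hconj_hconj [simp]: "hconj (hconj A) = A"
  by (simp add: vec_eq_iff)

lemma hconj_mat_1 [simp]: "hconj (mat 1) = mat 1"
  by (simp add: vec_eq_iff mat_def)

lemma hconj_add: "hconj (A + B) = hconj A + hconj B"
  by (simp add: vec_eq_iff)

lemma hconj_diff: "hconj (A - B) = hconj A - hconj B"
  by (simp add: vec_eq_iff)

lemma hconj_diag_real [simp]: "hconj (diag_real d) = diag_real d"
  by (simp add: vec_eq_iff diag_real_def)

lemma diag_real_nth: "diag_real d $ i $ j = (if i = j then complex_of_real (d i) else 0)"
  by (simp add: diag_real_def)

lemma mult_diag_real_nth: "(A ** diag_real d) $ i $ j = A $ i $ j * complex_of_real (d j)"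
proof -
  have "(A ** diag_real d) $ i $ j
      = (\<Sum>k\<in>UNIV. if k = j then A $ i $ k * complex_of_real (d k) else 0)"
    unfolding matrix_matrix_mult_def diag_real_def vec_lambda_beta by (rule sum.cong) auto
  then show ?thesis by simp
qed

lemma diag_real_mult_nth: "(diag_real d ** A) $ i $ j = complex_of_real (d i) * A $ i $ j"
proof -
  have "(diag_real d ** A) $ i $ j
      = (\<Sum>k\<in>UNIV. if k = i then complex_of_real (d k) * A $ k $ j else 0)"
    unfolding matrix_matrix_mult_def diag_real_def vec_lambda_beta by (rule sum.cong) auto
  then show ?thesis by simp
qed

lemma diag_real_vector_nth: "(diag_real d *v y) $ i = complex_of_real (d i) * y $ i"
proof -
  have "(diag_real d *v y) $ i
      = (\<Sum>k\<in>UNIV. if k = i then complex_of_real (d k) * y $ k else 0)"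
    unfolding matrix_vector_mult_def diag_real_def vec_lambda_beta by (rule sum.cong) auto
  then show ?thesis by simp
qed

lemma diag_real_mult: "diag_real a ** diag_real b = diag_real (\<lambda>i. a i * b i)"
  by (simp add: vec_eq_iff mult_diag_real_nth) (simp add: diag_real_nth)

lemma diag_real_mult_left:
  "diag_real a ** (diag_real b ** C) = diag_real (\<lambda>i. a i * b i) ** C"
  by (simp add: matrix_mul_assoc diag_real_mult)

lemma diag_real_add: "diag_real a + diag_real b = diag_real (\<lambda>i. a i + b i)"
  by (simp add: vec_eq_iff diag_real_nth)

lemma diag_real_one: "diag_real (\<lambda>i. 1) = mat 1"
  by (simp add: vec_eq_iff diag_real_nth mat_def)

text \<open>For unitary \<open>S\<close> this is a spectral decomposition; for merely invertible \<open>S\<close> it is the normal form of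
  a pencil of Hermitian matrices under congruence.\<close>

definition congr_diag :: "complex^'n^'n \<Rightarrow> ('n \<Rightarrow> real) \<Rightarrow> complex^'n^'n" where
  "congr_diag S d = S ** diag_real d ** hconj S"

lemma congr_diag_hermitian: "hconj (congr_diag S d) = congr_diag S d"
  by (simp add: congr_diag_def hconj_mult matrix_mul_assoc)

lemma congr_diag_one: "congr_diag S (\<lambda>i. 1) = S ** hconj S"
  by (simp add: congr_diag_def diag_real_one)

lemma congr_diag_congr: "K ** congr_diag S d ** hconj K = congr_diag (K ** S) d"
  by (simp add: congr_diag_def hconj_mult matrix_mul_assoc)

lemma congr_diag_scale:
  "congr_diag (S ** diag_real c) d = congr_diag S (\<lambda>i. (c i)\<^sup>2 * d i)"
  by (simp add: congr_diag_def hconj_mult matrix_mul_assoc[symmetric] diag_real_mult_left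
      power2_eq_square mult_ac)

lemma congr_diag_add: "congr_diag S a + congr_diag S b = congr_diag S (\<lambda>i. a i + b i)"
  by (simp add: congr_diag_def matrix_distribs[symmetric] diag_real_add)

lemma congr_diag_mult:
  fixes U :: "complex^'n^'n"
  assumes "hconj U ** U = mat 1"
  shows "congr_diag U a ** congr_diag U b = congr_diag U (\<lambda>i. a i * b i)"
proof -
  have "hconj U ** (U ** C) = C" for C :: "complex^'n^'n"
    using assms by (simp add: matrix_mul_assoc)
  then show ?thesis
    by (simp only: congr_diag_def matrix_mul_assoc[symmetric] diag_real_mult_left)
qed

lemma unitaryD: "unitary U \<Longrightarrow> hconj U ** U = mat 1" "unitary U \<Longrightarrow> U ** hconj U = mat 1"
  by (auto simp: unitary_def)

lemma unitary_hconj: "unitary U \<Longrightarrow> unitary (hconj U)"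
  by (simp add: unitary_def)

lemma unitary_mult: "unitary U \<Longrightarrow> unitary V \<Longrightarrow> unitary (U ** V)"
  unfolding unitary_def hconj_mult by (simp add: matrix_mult_cancel_mid)

lemma unitary_invertible: "unitary U \<Longrightarrow> invertible U"
  by (auto simp: unitary_def invertible_def)

lemma unitaryI: "hconj U ** U = mat 1 \<Longrightarrow> unitary U"
  by (simp add: unitary_def matrix_left_right_inverse)

lemma congr_diag_unitary_one: "unitary U \<Longrightarrow> congr_diag U (\<lambda>i. 1) = mat 1"
  by (simp add: congr_diag_one unitaryD)

text \<open>The link between matrices and the scalar inequalities below: a diagonal entry of this form is a
  combination of the numbers \<open>d m\<close>, and the weights add up to 1 when \<open>Q\<close> is unitary.\<close>

lemma quadratic_form_diag:
  "Re ((hconj Q ** diag_real d ** Q) $ j $ j) = (\<Sum>m\<in>UNIV. (cmod (Q $ m $ j))\<^sup>2 * d m)"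
proof -
  have "(hconj Q ** diag_real d ** Q) $ j $ j
      = (\<Sum>m\<in>UNIV. complex_of_real ((cmod (Q $ m $ j))\<^sup>2 * d m))"
    unfolding matrix_matrix_mult_def[of "hconj Q ** diag_real d"]
    by (simp add: mult_diag_real_nth complex_norm_square[unfolded of_real_power] mult_ac)
  then show ?thesis by simp
qed

lemma unitary_column_sum:
  "hconj Q ** Q = mat 1 \<Longrightarrow> (\<Sum>m\<in>UNIV. (cmod (Q $ m $ j))\<^sup>2) = 1"
  using quadratic_form_diag[of Q "\<lambda>i. 1" j] by (simp add: diag_real_one) (simp add: mat_def)

lemma unitary_row_sum:
  assumes "unitary Q" shows "(\<Sum>m\<in>UNIV. (cmod (Q $ j $ m))\<^sup>2) = 1"
  using unitary_column_sum[OF unitaryD(1)[OF unitary_hconj[OF assms]], of j] by simp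

section \<open>The spectral theorem\<close>

definition hdot :: "complex^'n \<Rightarrow> complex^'n \<Rightarrow> complex" where
  "hdot x y = (\<Sum>i\<in>UNIV. cnj (x $ i) * y $ i)"

lemma inner_eq_Re_hdot: "inner x y = Re (hdot x y)"
  by (simp add: inner_vec_def hdot_def inner_complex_def)

lemma hdot_add: "hdot x (y + z) = hdot x y + hdot x z" "hdot (y + z) x = hdot y x + hdot z x"
  by (simp_all add: hdot_def algebra_simps sum.distrib)

lemma hdot_diff: "hdot x (y - z) = hdot x y - hdot x z" "hdot (y - z) x = hdot y x - hdot z x"
  by (simp_all add: hdot_def algebra_simps sum_subtractf)

lemma hdot_smult: "hdot x (c *s y) = c * hdot x y" "hdot (c *s x) y = cnj c * hdot x y"
  by (simp_all add: hdot_def sum_distrib_left mult_ac)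

lemma hdot_commute: "hdot y x = cnj (hdot x y)"
  by (simp add: hdot_def mult.commute)

lemma hdot_zero [simp]: "hdot x 0 = 0" "hdot 0 x = 0"
  by (simp_all add: hdot_def)

lemma hdot_self: "hdot x x = complex_of_real ((norm x)\<^sup>2)"
proof -
  have "Re (hdot x x) = (norm x)\<^sup>2"
    by (simp add: inner_eq_Re_hdot[symmetric] power2_norm_eq_inner)
  moreover have "Im (hdot x x) = 0"
    by (simp add: hdot_def mult.commute)
  ultimately show ?thesis by (simp add: complex_eq_iff)
qed

lemma hdot_matrix: "hdot x (A *v y) = hdot (hconj A *v x) y"
proof -
  have "hdot x (A *v y) = (\<Sum>i\<in>UNIV. \<Sum>j\<in>UNIV. cnj (x $ i) * (A $ i $ j * y $ j))"
    by (simp add: hdot_def matrix_vector_mult_def sum_distrib_left)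
  also have "\<dots> = (\<Sum>j\<in>UNIV. \<Sum>i\<in>UNIV. cnj (x $ i) * (A $ i $ j * y $ j))"
    by (rule sum.swap)
  also have "\<dots> = hdot (hconj A *v x) y"
    unfolding hdot_def matrix_vector_mult_def vec_lambda_beta cnj_sum sum_distrib_right
    by (intro sum.cong refl) simp
  finally show ?thesis .
qed

lemma mult_eq_hdot_columns: "(hconj A ** B) $ i $ j = hdot (column i A) (column j B)"
  by (simp add: matrix_matrix_mult_def hdot_def column_def)

lemma nonneg_linear_plus_square_imp_zero:
  fixes b c :: real
  assumes "\<And>t. t * b + t\<^sup>2 * c \<ge> 0"
  shows "b = 0"
proof (rule ccontr)
  assume b: "b \<noteq> 0"
  define s where "s = 1 / (\<bar>c\<bar> + 1)"
  have s: "s > 0" "s * c < 1"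
    by (auto simp: s_def field_simps)
  have "0 \<le> (- (s * b)) * b + (- (s * b))\<^sup>2 * c" by (rule assms)
  also have "\<dots> = - (s * b\<^sup>2) * (1 - s * c)" by (simp add: power2_eq_square algebra_simps)
  finally have "0 \<le> - (s * b\<^sup>2) * (1 - s * c)" .
  moreover have "s * b\<^sup>2 > 0" using s b by simp
  ultimately show False using s(2)
    by (smt (verit) mult_minus_left mult_pos_pos)
qed

lemma exists_orthogonal_to_few:
  fixes u :: "nat \<Rightarrow> complex^'n"
  assumes "k < CARD('n)"
  obtains x where "x \<noteq> 0" "\<And>i. i < k \<Longrightarrow> hdot (u i) x = 0"
proof -
  define S where "S = u ` {..<k} \<union> (\<lambda>i. \<i> *s u i) ` {..<k}"
  have "card S \<le> card (u ` {..<k}) + card ((\<lambda>i. \<i> *s u i) ` {..<k})"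
    unfolding S_def by (rule card_Un_le)
  also have "\<dots> \<le> k + k"
    by (rule add_mono) (metis card_image_le card_lessThan finite_lessThan)+
  finally have "card S \<le> 2 * k" by simp
  moreover have "dim S \<le> card S"
    by (rule dim_le_card') (simp add: S_def)
  ultimately have "dim S < DIM(complex^'n)" using assms by simp
  then obtain x where x: "x \<noteq> 0" "\<And>y. y \<in> span S \<Longrightarrow> orthogonal x y"
    by (rule orthogonal_to_subspace_exists) auto
  have "hdot (u i) x = 0" if "i < k" for i
  proof -
    have "u i \<in> span S" "\<i> *s u i \<in> span S" using that by (auto simp: S_def intro!: span_base)
    then have "inner (u i) x = 0" "inner (\<i> *s u i) x = 0"
      using x(2) by (metis inner_commute orthogonal_def)+
    then show ?thesis by (simp add: inner_eq_Re_hdot hdot_smult complex_eq_iff)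
  qed
  then show ?thesis using that x(1) by blast
qed

text \<open>The next eigenvector maximises the quadratic form on the unit sphere of the orthogonal
  complement of the previous ones: the first variation of the Rayleigh quotient vanishes there
  in the direction of the residual itself, so the residual is zero.\<close>

lemma exists_eigenvector_orthogonal:
  fixes A :: "complex^'n^'n" and u :: "nat \<Rightarrow> complex^'n" and l :: "nat \<Rightarrow> real"
  assumes herm: "hermitian A" and k: "k < CARD('n)"
    and eig: "\<And>i. i < k \<Longrightarrow> A *v u i = complex_of_real (l i) *s u i"
  obtains v m where "norm v = 1" "A *v v = complex_of_real m *s v"
    "\<And>i. i < k \<Longrightarrow> hdot (u i) v = 0"
proof -
  define W where "W = {w. \<forall>i<k. hdot (u i) w = 0}"
  define q where "q w = Re (hdot w (A *v w))" for w
  obtain x where x: "x \<noteq> 0" "x \<in> W"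
    using exists_orthogonal_to_few[OF k, of u] by (auto simp: W_def)
  have hcont: "continuous_on UNIV (\<lambda>w. hdot (f w) (g w))"
    if "continuous_on UNIV f" "continuous_on UNIV g" for f g :: "complex^'n \<Rightarrow> complex^'n"
    unfolding hdot_def by (intro continuous_intros that)
  have lin: "continuous_on UNIV (\<lambda>w. A *v w)"
    by (rule matrix_vector_mult_linear_continuous_on)
  have "closed W"
  proof -
    have "W = (\<Inter>i\<in>{..<k}. {w. hdot (u i) w = 0})" by (auto simp: W_def)
    moreover have "closed {w. hdot (u i) w = 0}" for i
      by (rule closed_Collect_eq) (intro hcont continuous_intros)+
    ultimately show ?thesis by auto
  qed
  then have comp: "compact (sphere 0 1 \<inter> W)" by (simp add: compact_Int_closed)
  have Wscale: "c *s w \<in> W" if "w \<in> W" for c w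
    using that by (auto simp: W_def hdot_smult)
  have nscale: "norm (complex_of_real c *s w) = \<bar>c\<bar> * norm w" for c and w :: "complex^'n"
  proof -
    have "complex_of_real c *s w = c *\<^sub>R w"
      by (simp add: vec_eq_iff complex_eq_iff)
    then show ?thesis by simp
  qed
  have "complex_of_real (1 / norm x) *s x \<in> sphere 0 1 \<inter> W"
    using x Wscale unfolding Int_iff mem_sphere_0 nscale by simp
  then have ne: "sphere 0 1 \<inter> W \<noteq> {}" by blast
  have cont: "continuous_on (sphere 0 1 \<inter> W) q"
    unfolding q_def
    by (rule continuous_on_subset[OF _ subset_UNIV], rule continuous_on_Re,
        rule hcont[OF continuous_on_id lin])
  obtain v where v: "v \<in> sphere 0 1 \<inter> W"
    and vmax: "\<And>w. w \<in> sphere 0 1 \<inter> W \<Longrightarrow> q w \<le> q v"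
    using continuous_attains_sup[OF comp ne cont] by blast
  have nv: "norm v = 1" and vW: "v \<in> W" using v by auto
  define m where "m = q v"
  define r where "r = A *v v - complex_of_real m *s v"
  have qscale: "q (complex_of_real c *s w) = c\<^sup>2 * q w" for c w
    unfolding q_def vector_scalar_commute hdot_smult by (simp add: power2_eq_square)
  have qle: "q w \<le> m * (norm w)\<^sup>2" if w: "w \<in> W" for w
  proof (cases "w = 0")
    case False
    have "complex_of_real (1 / norm w) *s w \<in> sphere 0 1 \<inter> W"
      using w False Wscale unfolding Int_iff mem_sphere_0 nscale by simp
    from vmax[OF this] have "q w / (norm w)\<^sup>2 \<le> m"
      unfolding qscale m_def by (simp add: power_divide)
    then show ?thesis using False by (simp add: field_simps)
  qed (simp add: q_def)
  have hA: "hdot x (A *v y) = hdot (A *v x) y" for x y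
    using herm by (metis hdot_matrix hermitian_def)
  have rW: "r \<in> W"
    using vW by (auto simp: W_def r_def hdot_diff hdot_smult hA eig)
  have "t * (- 2 * Re (hdot r r)) + t\<^sup>2 * (m * (norm r)\<^sup>2 - q r) \<ge> 0" for t
  proof -
    define y where "y = v + complex_of_real t *s r"
    have "y \<in> W" using vW rW by (auto simp: y_def W_def hdot_add hdot_smult)
    then have "q y \<le> m * Re (hdot y y)" using qle by (simp add: hdot_self)
    moreover have "q y = q v + 2 * t * Re (hdot r (A *v v)) + t\<^sup>2 * q r"
    proof -
      have 1: "A *v y = A *v v + complex_of_real t *s (A *v r)"
        by (simp add: y_def matrix_vector_right_distrib vector_scalar_commute)
      have 2: "hdot v (A *v r) = cnj (hdot r (A *v v))"
        by (metis hA hdot_commute)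
      show ?thesis
        unfolding q_def 1 unfolding y_def hdot_add hdot_smult 2
        by (simp add: power2_eq_square algebra_simps)
    qed
    moreover have "Re (hdot y y) = 1 + 2 * t * Re (hdot r v) + t\<^sup>2 * (norm r)\<^sup>2"
    proof -
      have "hdot v v = 1" by (simp add: hdot_self nv)
      moreover have "hdot v r = cnj (hdot r v)" by (rule hdot_commute)
      ultimately show ?thesis
        unfolding y_def hdot_add hdot_smult hdot_self[of r]
        by (simp add: power2_eq_square algebra_simps)
    qed
    moreover have "Re (hdot r (A *v v)) = Re (hdot r r) + m * Re (hdot r v)"
      by (subst (3) r_def) (simp add: hdot_diff hdot_smult)
    ultimately show ?thesis unfolding m_def[symmetric] by (simp add: algebra_simps)
  qed
  then have "- 2 * Re (hdot r r) = 0" by (rule nonneg_linear_plus_square_imp_zero)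
  then have "r = 0" by (simp add: hdot_self)
  then have "A *v v = complex_of_real m *s v" by (simp add: r_def)
  with that nv vW show ?thesis by (auto simp: W_def)
qed

lemma exists_orthonormal_eigenvectors:
  fixes A :: "complex^'n^'n"
  assumes herm: "hermitian A" and "k \<le> CARD('n)"
  shows "\<exists>u l. (\<forall>i<k. \<forall>j<k. hdot (u i) (u j) = (if i = j then 1 else 0)) \<and>
    (\<forall>i<k. A *v u i = complex_of_real (l i) *s u i)"
  using assms(2)
proof (induction k)
  case (Suc k)
  then obtain u l where ul: "\<And>i j. i < k \<Longrightarrow> j < k \<Longrightarrow> hdot (u i) (u j) = (if i = j then 1 else 0)"
    "\<And>i. i < k \<Longrightarrow> A *v u i = complex_of_real (l i) *s u i" by auto
  from exists_eigenvector_orthogonal[OF herm, of k u l] Suc.prems ul(2)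
  obtain v m where v: "norm v = 1" "A *v v = complex_of_real m *s v"
    "\<And>i. i < k \<Longrightarrow> hdot (u i) v = 0" by (metis Suc_le_lessD)
  have v': "hdot v (u i) = 0" if "i < k" for i
    using v(3)[OF that] hdot_commute[of v "u i"] by simp
  show ?case
    by (rule exI[of _ "u(k := v)"], rule exI[of _ "l(k := m)"])
      (use ul v v' in \<open>auto simp: less_Suc_eq hdot_self\<close>)
qed auto

theorem spectral_theorem:
  fixes A :: "complex^'n^'n"
  assumes "hermitian A"
  obtains U d where "unitary U" "A = congr_diag U d"
proof -
  obtain u l where u: "\<And>i j. i < CARD('n) \<Longrightarrow> j < CARD('n) \<Longrightarrow>
      hdot (u i) (u j) = (if i = j then 1 else 0)"
    and l: "\<And>i. i < CARD('n) \<Longrightarrow> A *v u i = complex_of_real (l i) *s u i"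
    using exists_orthonormal_eigenvectors[OF assms order_refl] by metis
  obtain e :: "'n \<Rightarrow> nat" where e: "bij_betw e UNIV {..<CARD('n)}"
    using ex_bij_betw_finite_nat[of "UNIV :: 'n set"] by (auto simp: atLeast0LessThan)
  have elt: "e i < CARD('n)" for i using e by (auto simp: bij_betw_def)
  have einj: "e i = e j \<longleftrightarrow> i = j" for i j using e by (auto simp: bij_betw_def inj_on_def)
  define U where "U = (\<chi> r c. u (e c) $ r)"
  have col: "column j U = u (e j)" for j by (simp add: column_def U_def vec_eq_iff)
  have "hconj U ** U = mat 1"
    by (simp add: vec_eq_iff mult_eq_hdot_columns col u elt einj mat_def)
  then have U: "unitary U" by (rule unitaryI)
  have "A ** U = U ** diag_real (\<lambda>i. l (e i))"
  proof (simp add: vec_eq_iff mult_diag_real_nth, intro allI)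
    fix i j
    have "(A ** U) $ i $ j = (A *v u (e j)) $ i"
      by (simp add: matrix_matrix_mult_def matrix_vector_mult_def U_def)
    also have "\<dots> = U $ i $ j * complex_of_real (l (e j))"
      by (simp add: l elt U_def)
    finally show "(A ** U) $ i $ j = U $ i $ j * complex_of_real (l (e j))" .
  qed
  then have "A = congr_diag U (\<lambda>i. l (e i))"
    unfolding congr_diag_def
    by (metis U unitaryD(2) matrix_mul_assoc matrix_mul_rid)
  with U that show ?thesis by blast
qed

section \<open>Functional calculus and positive definite matrices\<close>

text \<open>The functional calculus does not depend on the diagonalisation: if \<open>W = hconj V ** U\<close>
  intertwines two diagonal matrices, then \<open>W $ i $ j\<close> can be nonzero only where the corresponding
  eigenvalues agree, so it also intertwines their images under \<open>f\<close>.\<close>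

lemma congr_diag_unitary_functional:
  assumes U: "unitary U" and V: "unitary V" and eq: "congr_diag U d = congr_diag V e"
  shows "congr_diag U (\<lambda>i. f (d i)) = congr_diag V (\<lambda>i. f (e i))"
proof -
  define W where "W = hconj V ** U"
  have "W ** diag_real d = hconj V ** (congr_diag U d ** U)"
    unfolding W_def congr_diag_def using unitaryD[OF U] by (simp add: matrix_mul_assoc[symmetric])
  also have "\<dots> = (hconj V ** V) ** (diag_real e ** W)"
    unfolding eq unfolding W_def congr_diag_def by (simp add: matrix_mul_assoc)
  finally have "W ** diag_real d = diag_real e ** W"
    using unitaryD[OF V] by simp
  then have *: "W $ i $ j * complex_of_real (d j) = complex_of_real (e i) * W $ i $ j" for i j
    by (metis mult_diag_real_nth diag_real_mult_nth)
  have "W $ i $ j * complex_of_real (f (d j)) = complex_of_real (f (e i)) * W $ i $ j" for i j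
    using *[of i j] by (cases "W $ i $ j = 0") auto
  then have "W ** diag_real (\<lambda>i. f (d i)) = diag_real (\<lambda>i. f (e i)) ** W"
    by (simp add: vec_eq_iff mult_diag_real_nth diag_real_mult_nth)
  then have "V ** (W ** diag_real (\<lambda>i. f (d i))) ** hconj U
      = V ** (diag_real (\<lambda>i. f (e i)) ** W) ** hconj U" by simp
  moreover have "V ** (W ** diag_real (\<lambda>i. f (d i))) ** hconj U = (V ** hconj V) ** congr_diag U (\<lambda>i. f (d i))"
    by (simp add: W_def congr_diag_def matrix_mul_assoc)
  moreover have "V ** (diag_real (\<lambda>i. f (e i)) ** W) ** hconj U = congr_diag V (\<lambda>i. f (e i)) ** (U ** hconj U)"
    by (simp add: W_def congr_diag_def matrix_mul_assoc)
  ultimately show ?thesis using unitaryD[OF U] unitaryD[OF V] by simp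
qed

lemma matfun_congr_diag:
  assumes "unitary U"
  shows "matfun f (congr_diag U d) = congr_diag U (\<lambda>i. f (d i))"
  unfolding matfun_def congr_diag_def[symmetric]
  by (rule the_equality) (use assms in \<open>blast, metis congr_diag_unitary_functional\<close>)

lemma trace_congr_diag:
  assumes "unitary U"
  shows "trace (congr_diag U d) = complex_of_real (\<Sum>i\<in>UNIV. d i)"
proof -
  have "trace (congr_diag U d) = trace (hconj U ** (U ** diag_real d))"
    unfolding congr_diag_def by (rule trace_mul_sym)
  also have "\<dots> = trace (diag_real d)"
    using unitaryD[OF assms] by (simp add: matrix_mul_assoc)
  finally show ?thesis by (simp add: trace_def diag_real_nth)
qed

lemma hdot_congr_diag:
  "Re (hdot x (congr_diag S d *v x)) = (\<Sum>i\<in>UNIV. d i * (cmod ((hconj S *v x) $ i))\<^sup>2)"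
proof -
  define y where "y = hconj S *v x"
  have "hdot x (congr_diag S d *v x) = hdot y (diag_real d *v y)"
    by (simp add: congr_diag_def y_def matrix_vector_mul_assoc[symmetric] hdot_matrix[of x S])
  moreover have "Re (hdot y (diag_real d *v y)) = (\<Sum>i\<in>UNIV. d i * (cmod (y $ i))\<^sup>2)"
    unfolding cmod_power2
    by (simp add: hdot_def diag_real_vector_nth power2_eq_square algebra_simps)
  ultimately show ?thesis by (simp add: y_def)
qed

lemma posdef_iff: "A \<in> posdef \<longleftrightarrow> hermitian A \<and> (\<forall>x. x \<noteq> 0 \<longrightarrow> Re (hdot x (A *v x)) > 0)"
  by (simp add: posdef_def hdot_def matrix_vector_mult_def sum_distrib_left mult_ac)

lemma invertible_hconj: "invertible S \<Longrightarrow> invertible (hconj S)"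
  unfolding invertible_def by (metis hconj_mult hconj_mat_1)

lemma invertible_mult_vector_eq_0:
  "invertible (S :: complex^'n^'n) \<Longrightarrow> S *v x = 0 \<longleftrightarrow> x = 0"
  unfolding invertible_def
  by (metis matrix_vector_mul_assoc matrix_vector_mul_lid matrix_vector_mult_0_right)

lemma posdef_congr_diag:
  assumes S: "invertible S" and d: "\<And>i. d i > 0"
  shows "congr_diag S d \<in> posdef"
proof -
  have "Re (hdot x (congr_diag S d *v x)) > 0" if "x \<noteq> 0" for x
  proof -
    have "hconj S *v x \<noteq> 0"
      using that invertible_mult_vector_eq_0[OF invertible_hconj[OF S]] by blast
    then obtain i where "(hconj S *v x) $ i \<noteq> 0" by (auto simp: vec_eq_iff)
    then show ?thesis
      unfolding hdot_congr_diag using d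
      by (intro sum_pos2[of _ i]) (auto simp: less_imp_le)
  qed
  then show ?thesis by (simp add: posdef_iff hermitian_def congr_diag_hermitian)
qed

lemma posdef_congruence:
  fixes K :: "complex^'n^'n"
  assumes K: "invertible K" and B: "B \<in> posdef"
  shows "K ** B ** hconj K \<in> posdef"
proof -
  have "hdot x ((K ** B ** hconj K) *v x) = hdot (hconj K *v x) (B *v (hconj K *v x))" for x
    by (simp add: matrix_vector_mul_assoc[symmetric] hdot_matrix[of x K])
  then show ?thesis
    using B invertible_mult_vector_eq_0[OF invertible_hconj[OF K]]
    by (auto simp: posdef_iff hermitian_def hconj_mult matrix_mul_assoc)
qed

lemma posdef_mat_1: "mat 1 \<in> posdef"
proof -
  have "invertible (mat 1 :: complex^'n^'n)" by (auto simp: invertible_def)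
  from posdef_congr_diag[OF this, of "\<lambda>i. 1"] show ?thesis by (simp add: congr_diag_one)
qed

lemma posdef_spectral:
  assumes "A \<in> posdef"
  obtains U a where "unitary U" "A = congr_diag U (\<lambda>i. exp (a i))"
proof -
  obtain U d where U: "unitary U" and A: "A = congr_diag U d"
    using assms spectral_theorem by (auto simp: posdef_iff)
  have "d i > 0" for i
  proof -
    define x where "x = U *v axis i 1"
    have y: "hconj U *v x = axis i 1"
      using unitaryD[OF U] by (simp add: x_def matrix_vector_mul_assoc)
    then have "x \<noteq> 0" by (metis axis_eq_0_iff matrix_vector_mult_0_right zero_neq_one)
    then have "0 < Re (hdot x (A *v x))" using assms by (simp add: posdef_iff)
    also have "\<dots> = (\<Sum>j\<in>UNIV. if j = i then d j else 0)"
      unfolding A hdot_congr_diag y by (intro sum.cong) (auto simp: axis_def)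
    finally show ?thesis by simp
  qed
  then have "A = congr_diag U (\<lambda>i. exp (ln (d i)))" by (simp add: A)
  with U show ?thesis by (rule that)
qed

text \<open>Two positive definite matrices are congruent, by a common \<open>S\<close>, to the identity and to a
  diagonal matrix.  Distance and geometric mean are invariant under congruence, so in these
  coordinates both are given by the logarithms \<open>z\<close> of the diagonal entries alone.\<close>

lemma posdef_simultaneous_diag:
  assumes A: "A \<in> posdef" and B: "B \<in> posdef"
  obtains S z where "invertible S" "A = S ** hconj S" "B = congr_diag S (\<lambda>i. exp (z i))"
proof -
  obtain U a where U: "unitary U" and Aeq: "A = congr_diag U (\<lambda>i. exp (a i))"
    using posdef_spectral[OF A] .
  define R where "R = U ** diag_real (\<lambda>i. exp (a i / 2))"
  define R' where "R' = diag_real (\<lambda>i. exp (- a i / 2)) ** hconj U"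
  have "R' ** R = mat 1"
    unfolding R_def R'_def
    by (subst matrix_mult_cancel_mid[OF unitaryD(1)[OF U]])
      (simp add: diag_real_mult exp_add[symmetric] diag_real_one)
  then have RR': "R' ** R = mat 1" "R ** R' = mat 1" by (auto simp: matrix_left_right_inverse)
  then have invR: "invertible R" "invertible R'" by (auto simp: invertible_def)
  have ARR: "A = R ** hconj R"
    unfolding congr_diag_one[symmetric] R_def congr_diag_scale
    by (simp add: Aeq exp_double[symmetric])
  obtain V z where V: "unitary V" and Beq: "R' ** B ** hconj R' = congr_diag V (\<lambda>i. exp (z i))"
    using posdef_spectral[OF posdef_congruence[OF invR(2) B]] .
  have "R ** (R' ** B ** hconj R') ** hconj R = (R ** R') ** B ** hconj (R ** R')"
    by (simp add: hconj_mult matrix_mul_assoc)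
  then have "B = congr_diag (R ** V) (\<lambda>i. exp (z i))"
    unfolding Beq congr_diag_congr by (simp add: RR')
  moreover have "A = (R ** V) ** hconj (R ** V)"
    unfolding ARR hconj_mult by (simp add: matrix_mult_cancel_mid unitaryD[OF V])
  moreover have "invertible (R ** V)"
    by (simp add: invertible_mult invR unitary_invertible V)
  ultimately show ?thesis using that by blast
qed

lemma schatten_norm_powr:
  assumes U: "unitary U" and p: "p > 0"
  shows "schatten_norm p (congr_diag U d) powr p = (\<Sum>i\<in>UNIV. \<bar>d i\<bar> powr p)"
proof -
  have "hconj (congr_diag U d) ** congr_diag U d = congr_diag U (\<lambda>i. (d i)\<^sup>2)"
    using U by (simp add: congr_diag_hermitian congr_diag_mult unitaryD power2_eq_square)
  then have "matabs (congr_diag U d) = congr_diag U (\<lambda>i. \<bar>d i\<bar>)"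
    using U by (simp add: matabs_def matpow_def matfun_congr_diag powr_half_sqrt)
  then have "Re (trace (matpow (matabs (congr_diag U d)) p)) = (\<Sum>i\<in>UNIV. \<bar>d i\<bar> powr p)"
    using U by (simp add: matpow_def matfun_congr_diag trace_congr_diag)
  moreover have "(\<Sum>i\<in>UNIV. \<bar>d i\<bar> powr p) \<ge> 0" by (intro sum_nonneg) simp
  ultimately show ?thesis using p by (simp add: schatten_norm_def powr_powr)
qed

text \<open>Any \<open>S\<close> with \<open>A = S ** hconj S\<close> differs from the positive square root of \<open>A\<close> by a unitary
  factor, which the spectrum does not see.\<close>

lemma posdef_root_unitary:
  assumes S: "invertible S"
  obtains W where "unitary W"
    "matpow (S ** hconj S) (1/2) ** W = S" "matpow (S ** hconj S) (-1/2) ** S = W"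
    "hconj (matpow (S ** hconj S) (1/2)) = matpow (S ** hconj S) (1/2)"
    "hconj (matpow (S ** hconj S) (-1/2)) = matpow (S ** hconj S) (-1/2)"
proof -
  have "S ** hconj S \<in> posdef"
    using posdef_congr_diag[OF S, of "\<lambda>i. 1"] by (simp add: congr_diag_one)
  then obtain U a where U: "unitary U" and A: "S ** hconj S = congr_diag U (\<lambda>i. exp (a i))"
    by (rule posdef_spectral)
  define H where "H = congr_diag U (\<lambda>i. exp (a i / 2))"
  define N where "N = congr_diag U (\<lambda>i. exp (- a i / 2))"
  have H: "matpow (S ** hconj S) (1/2) = H" and N: "matpow (S ** hconj S) (-1/2) = N"
    unfolding A matpow_def matfun_congr_diag[OF U] H_def N_def
    by (simp_all add: powr_def)
  have UU: "hconj U ** U = mat 1" using U by (rule unitaryD)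
  have NH: "N ** (S ** hconj S) ** N = mat 1" "H ** N = mat 1"
    unfolding A H_def N_def congr_diag_mult[OF UU]
    by (simp_all add: exp_add[symmetric] congr_diag_unitary_one[OF U])
  have herm: "hconj H = H" "hconj N = N" by (simp_all add: H_def N_def congr_diag_hermitian)
  have "(N ** S) ** hconj (N ** S) = mat 1"
    using NH by (simp add: hconj_mult herm matrix_mul_assoc)
  then have "unitary (N ** S)"
    using unitary_hconj[OF unitaryI[of "hconj (N ** S)"]] by simp
  moreover have "H ** (N ** S) = S" using NH by (simp add: matrix_mul_assoc)
  ultimately show ?thesis
    using that[of "N ** S"] unfolding H N by (simp add: herm)
qed

lemma pd_dist_congr_diag:
  assumes S: "invertible S" and p: "p > 0"
  shows "pd_dist p (S ** hconj S) (congr_diag S (\<lambda>i. exp (z i))) powr p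
    = (\<Sum>i\<in>UNIV. \<bar>z i\<bar> powr p)"
proof -
  define N where "N = matpow (S ** hconj S) (-1/2)"
  obtain W where W: "unitary W" "N ** S = W" "hconj N = N"
    unfolding N_def using posdef_root_unitary[OF S] by metis
  have "N ** congr_diag S (\<lambda>i. exp (z i)) ** N = congr_diag W (\<lambda>i. exp (z i))"
    using congr_diag_congr[of N S "\<lambda>i. exp (z i)"] by (simp add: W)
  then have "pd_dist p (S ** hconj S) (congr_diag S (\<lambda>i. exp (z i)))
      = schatten_norm p (congr_diag W z)"
    by (simp add: pd_dist_def N_def matlog_def matfun_congr_diag W)
  then show ?thesis by (simp add: schatten_norm_powr W p)
qed

lemma geom_mean_congr_diag:
  assumes S: "invertible S"
  shows "geom_mean (S ** hconj S) (congr_diag S (\<lambda>i. exp (z i)))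
    = congr_diag S (\<lambda>i. exp (z i / 2))"
proof -
  define N where "N = matpow (S ** hconj S) (-1/2)"
  define H where "H = matpow (S ** hconj S) (1/2)"
  obtain W where W: "unitary W" "N ** S = W" "hconj N = N" "H ** W = S" "hconj H = H"
    unfolding N_def H_def using posdef_root_unitary[OF S] by metis
  have "N ** congr_diag S (\<lambda>i. exp (z i)) ** N = congr_diag W (\<lambda>i. exp (z i))"
    using congr_diag_congr[of N S "\<lambda>i. exp (z i)"] by (simp add: W)
  then have "matpow (N ** congr_diag S (\<lambda>i. exp (z i)) ** N) (1/2)
      = congr_diag W (\<lambda>i. exp (z i / 2))"
    by (simp add: matpow_def matfun_congr_diag W powr_def)
  then have "geom_mean (S ** hconj S) (congr_diag S (\<lambda>i. exp (z i)))
      = H ** congr_diag W (\<lambda>i. exp (z i / 2)) ** H"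
    by (simp add: geom_mean_def N_def H_def[symmetric])
  then show ?thesis using congr_diag_congr[of H W "\<lambda>i. exp (z i / 2)"] by (simp add: W)
qed

lemma pd_dist_congruence:
  fixes K :: "complex^'n^'n"
  assumes A: "A \<in> posdef" and B: "B \<in> posdef" and K: "invertible K" and p: "p > 0"
  shows "pd_dist p (K ** A ** hconj K) (K ** B ** hconj K) powr p = pd_dist p A B powr p"
proof -
  obtain S z where S: "invertible S" and eq: "A = S ** hconj S" "B = congr_diag S (\<lambda>i. exp (z i))"
    using posdef_simultaneous_diag[OF A B] .
  have "K ** A ** hconj K = (K ** S) ** hconj (K ** S)"
    by (simp add: eq hconj_mult matrix_mul_assoc)
  moreover have "K ** B ** hconj K = congr_diag (K ** S) (\<lambda>i. exp (z i))"
    by (simp add: eq congr_diag_congr)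
  ultimately show ?thesis
    using pd_dist_congr_diag[OF S p, of z] pd_dist_congr_diag[OF invertible_mult[OF K S] p, of z]
    by (simp add: eq)
qed

section \<open>Convexity of real powers\<close>

lemma powr_gt_tangent_at_1:
  fixes t p :: real
  assumes t: "t > 0" "t \<noteq> 1" and p: "p > 1"
  shows "t powr p > 1 + p * (t - 1)"
proof -
  define g where "g t = t powr p - p * t" for t :: real
  have der: "(g has_real_derivative p * (s powr (p - 1) - 1)) (at s)" if "s > 0" for s
    unfolding g_def using that by (auto intro!: derivative_eq_intros simp: algebra_simps)
  show ?thesis
  proof (cases "t > 1")
    case True
    obtain c where c: "1 < c" "g t - g 1 = (t - 1) * (p * (c powr (p - 1) - 1))"
      using MVT2[OF True, of g "\<lambda>s. p * (s powr (p - 1) - 1)"] der by force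
    have "c powr (p - 1) > 1 powr (p - 1)" using c p by (intro powr_less_mono2) auto
    then have "g t - g 1 > 0" unfolding c using True p by auto
    then show ?thesis by (simp add: g_def algebra_simps)
  next
    case False
    then have t1: "t < 1" using t by simp
    obtain c where c: "t < c" "c < 1" "g 1 - g t = (1 - t) * (p * (c powr (p - 1) - 1))"
      using MVT2[OF t1, of g "\<lambda>s. p * (s powr (p - 1) - 1)"] der t by force
    have "c powr (p - 1) < 1 powr (p - 1)" using c p t by (intro powr_less_mono2) auto
    then have "g 1 - g t < 0" unfolding c using t1 p by (intro mult_pos_neg) auto
    then show ?thesis by (simp add: g_def algebra_simps)
  qed
qed

definition abs_powr_deriv :: "real \<Rightarrow> real \<Rightarrow> real" where
  "abs_powr_deriv p x = p * (sgn x * \<bar>x\<bar> powr (p - 1))"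

lemma abs_powr_gt_tangent:
  fixes x y p :: real
  assumes p: "p > 1" and xy: "x \<noteq> y"
  shows "\<bar>y\<bar> powr p > \<bar>x\<bar> powr p + abs_powr_deriv p x * (y - x)"
proof (cases "x = 0")
  case True
  then show ?thesis using xy p by (simp add: abs_powr_deriv_def)
next
  case False
  define t where "t = y / x"
  have y: "y = t * x" using False by (simp add: t_def)
  have t1: "t \<noteq> 1" using xy y by auto
  have "\<bar>t\<bar> powr p > 1 + p * (t - 1)"
  proof (cases "t > 0")
    case True
    then show ?thesis using powr_gt_tangent_at_1[of t p] t1 p by simp
  next
    case False
    then have "p * (t - 1) \<le> p * (-1)" using p by (intro mult_left_mono) auto
    then have "1 + p * (t - 1) < 0" using p by simp
    moreover have "\<bar>t\<bar> powr p \<ge> 0" by simp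
    ultimately show ?thesis by linarith
  qed
  then have "\<bar>x\<bar> powr p * (1 + p * (t - 1)) < \<bar>x\<bar> powr p * \<bar>t\<bar> powr p"
    using False by simp
  moreover have "\<bar>y\<bar> powr p = \<bar>x\<bar> powr p * \<bar>t\<bar> powr p"
    by (simp add: y abs_mult powr_mult)
  moreover have "abs_powr_deriv p x * (y - x) = \<bar>x\<bar> powr p * (p * (t - 1))"
  proof -
    have "\<bar>x\<bar> powr p = \<bar>x\<bar> powr (p - 1) * \<bar>x\<bar>"
      using False powr_add[of "\<bar>x\<bar>" "p - 1" 1] by simp
    moreover have "\<bar>x\<bar> = sgn x * x" by (simp add: sgn_if)
    ultimately have "\<bar>x\<bar> powr p = \<bar>x\<bar> powr (p - 1) * (sgn x * x)" by metis
    then show ?thesis by (simp add: abs_powr_deriv_def y algebra_simps)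
  qed
  ultimately show ?thesis by (simp add: algebra_simps)
qed

lemma abs_powr_ge_tangent:
  fixes x y p :: real
  assumes "p > 1"
  shows "\<bar>y\<bar> powr p \<ge> \<bar>x\<bar> powr p + abs_powr_deriv p x * (y - x)"
  using abs_powr_gt_tangent[of p x y] assms by (cases "x = y") auto

lemma abs_powr_deriv_mono:
  assumes p: "p > 1" and xy: "x \<le> y"
  shows "abs_powr_deriv p x \<le> abs_powr_deriv p y"
proof (cases "x = y")
  case False
  have "(abs_powr_deriv p y - abs_powr_deriv p x) * (y - x) \<ge> 0"
    using abs_powr_ge_tangent[OF p, of x y] abs_powr_ge_tangent[OF p, of y x]
    by (simp add: algebra_simps)
  then show ?thesis using False xy by (simp add: zero_le_mult_iff)
qed simp

text \<open>Klein's inequality \<open>Tr f(Z) \<ge> Tr f(X) + Tr f'(X)(Z - X)\<close> for \<open>f(t) = |t|^p\<close>, written in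
  terms of the eigenvalues \<open>z\<close>, \<open>x\<close> of the two Hermitian matrices and of the squared moduli \<open>s\<close>
  of the inner products of their eigenvectors.\<close>

lemma klein_inequality:
  fixes s :: "'n::finite \<Rightarrow> 'n \<Rightarrow> real" and x z :: "'n \<Rightarrow> real"
  assumes p: "p > 1" and s: "\<And>i j. s i j \<ge> 0"
    and row: "\<And>i. (\<Sum>j\<in>UNIV. s i j) = 1" and col: "\<And>j. (\<Sum>i\<in>UNIV. s i j) = 1"
  shows "(\<Sum>i\<in>UNIV. \<bar>x i\<bar> powr p)
      + (\<Sum>i\<in>UNIV. abs_powr_deriv p (x i) * ((\<Sum>j\<in>UNIV. s i j * z j) - x i))
    \<le> (\<Sum>j\<in>UNIV. \<bar>z j\<bar> powr p)" (is "?L \<le> ?R")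
    and "s a b \<noteq> 0 \<Longrightarrow> z b \<noteq> x a \<Longrightarrow>
      (\<Sum>i\<in>UNIV. \<bar>x i\<bar> powr p)
        + (\<Sum>i\<in>UNIV. abs_powr_deriv p (x i) * ((\<Sum>j\<in>UNIV. s i j * z j) - x i))
      < (\<Sum>j\<in>UNIV. \<bar>z j\<bar> powr p)"
proof -
  let ?t = "\<lambda>i j. \<bar>x i\<bar> powr p + abs_powr_deriv p (x i) * (z j - x i)"
  have "(\<Sum>j\<in>UNIV. s i j * ?t i j)
      = \<bar>x i\<bar> powr p + abs_powr_deriv p (x i) * ((\<Sum>j\<in>UNIV. s i j * z j) - x i)" for i
  proof -
    have "(\<Sum>j\<in>UNIV. s i j * ?t i j) = (\<Sum>j\<in>UNIV. s i j) * (\<bar>x i\<bar> powr p - abs_powr_deriv p (x i) * x i)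
        + abs_powr_deriv p (x i) * (\<Sum>j\<in>UNIV. s i j * z j)"
      unfolding sum_distrib_left sum_distrib_right sum.distrib[symmetric]
      by (intro sum.cong) (auto simp: algebra_simps)
    then show ?thesis by (simp add: row algebra_simps)
  qed
  then have L: "?L = (\<Sum>i\<in>UNIV. \<Sum>j\<in>UNIV. s i j * ?t i j)"
    by (simp add: sum.distrib)
  have R: "?R = (\<Sum>i\<in>UNIV. \<Sum>j\<in>UNIV. s i j * \<bar>z j\<bar> powr p)"
    by (subst sum.swap) (simp add: sum_distrib_right[symmetric] col)
  have le: "s i j * ?t i j \<le> s i j * \<bar>z j\<bar> powr p" for i j
    by (intro mult_left_mono abs_powr_ge_tangent s p)
  show "?L \<le> ?R" unfolding L R by (intro sum_mono le)
  assume ab: "s a b \<noteq> 0" "z b \<noteq> x a"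
  have "s a b * ?t a b < s a b * \<bar>z b\<bar> powr p"
    using ab s[of a b] by (intro mult_strict_left_mono abs_powr_gt_tangent p) auto
  then have "(\<Sum>j\<in>UNIV. s a j * ?t a j) < (\<Sum>j\<in>UNIV. s a j * \<bar>z j\<bar> powr p)"
    using le by (intro sum_strict_mono_ex1) auto
  then show "?L < ?R" unfolding L R
    using le by (intro sum_strict_mono_ex1) (auto intro!: sum_mono)
qed

section \<open>A multiplicative Weyl inequality\<close>

lemma exists_sorting_rank:
  fixes x :: "'n::finite \<Rightarrow> real"
  obtains r :: "'n \<Rightarrow> nat" where "inj r" "\<And>i j. r i < r j \<Longrightarrow> x i \<le> x j"
proof -
  obtain e :: "'n \<Rightarrow> nat" where e: "inj e"
    using finite_imp_inj_to_nat_seg[of "UNIV :: 'n set"] by auto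
  define lt where "lt i j \<longleftrightarrow> x i < x j \<or> (x i = x j \<and> e i < e j)" for i j
  define r where "r i = card {j. lt j i}" for i
  have less: "r i < r j" if "lt i j" for i j
    unfolding r_def
  proof (rule psubset_card_mono)
    have "{k. lt k i} \<subseteq> {k. lt k j}" using that by (auto simp: lt_def)
    moreover have "i \<in> {k. lt k j}" "i \<notin> {k. lt k i}" using that by (auto simp: lt_def)
    ultimately show "{k. lt k i} \<subset> {k. lt k j}" by blast
  qed simp
  have total: "i = j \<or> lt i j \<or> lt j i" for i j
    using injD[OF e, of i j] by (auto simp: lt_def) (meson linorder_neqE_nat)+
  have "inj r"
    by (rule injI) (metis less total less_irrefl)
  moreover have "x i \<le> x j" if "r i < r j" for i j
    using total[of i j] less[of j i] that by (auto simp: lt_def)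
  ultimately show ?thesis using that by blast
qed

text \<open>Abel summation along the ranks.  They need not be consecutive: a gap adds no term.\<close>

lemma abel_summation_le:
  fixes r :: "'n::finite \<Rightarrow> nat" and \<kappa> \<delta> :: "'n \<Rightarrow> real"
  assumes r: "inj r" and mono: "\<And>i j. r i < r j \<Longrightarrow> \<kappa> i \<le> \<kappa> j"
    and part: "\<And>k. (\<Sum>i | r i < k. \<delta> i) \<le> 0"
    and total: "(\<Sum>i\<in>UNIV. \<delta> i) = 0"
  shows "(\<Sum>i\<in>UNIV. \<kappa> i * \<delta> i) \<ge> 0"
proof -
  have *: "c * (\<Sum>i | r i < k. \<delta> i) \<le> (\<Sum>i | r i < k. \<kappa> i * \<delta> i)"
    if "\<And>i. r i < k \<Longrightarrow> \<kappa> i \<le> c" for k c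
    using that
  proof (induction k arbitrary: c)
    case (Suc k)
    show ?case
    proof (cases "\<exists>a. r a = k")
      case False
      then have "{i. r i < Suc k} = {i. r i < k}" by (auto simp: less_Suc_eq)
      then show ?thesis using Suc by (metis less_SucI)
    next
      case True
      then obtain a where a: "r a = k" by blast
      then have split: "{i. r i < Suc k} = insert a {i. r i < k}"
        using r by (auto simp: less_Suc_eq inj_def)
      have "c * (\<Sum>i | r i < Suc k. \<delta> i) \<le> \<kappa> a * (\<Sum>i | r i < Suc k. \<delta> i)"
        using Suc.prems[of a] a part[of "Suc k"] by (intro mult_right_mono_neg) auto
      also have "\<dots> = \<kappa> a * \<delta> a + \<kappa> a * (\<Sum>i | r i < k. \<delta> i)"
        unfolding split using a by (simp add: distrib_left)
      also have "\<dots> \<le> \<kappa> a * \<delta> a + (\<Sum>i | r i < k. \<kappa> i * \<delta> i)"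
        using Suc.IH[of "\<kappa> a"] mono a by auto
      also have "\<dots> = (\<Sum>i | r i < Suc k. \<kappa> i * \<delta> i)"
        unfolding split using a by simp
      finally show ?thesis .
    qed
  qed simp
  define k where "k = Suc (Max (range r))"
  have all: "{i. r i < k} = UNIV" by (auto simp: k_def less_Suc_eq_le)
  show ?thesis
    using *[of k "Max (range \<kappa>)"] total by (simp add: all)
qed

lemma mult_hconj_trace_eq_0:
  assumes "Re (trace (hconj X ** X)) = 0"
  shows "X = 0"
proof -
  have "Re (trace (hconj X ** X)) = (\<Sum>j\<in>UNIV. \<Sum>m\<in>UNIV. (cmod (X $ m $ j))\<^sup>2)"
    using quadratic_form_diag[of X "\<lambda>i. 1"] by (simp add: trace_def diag_real_one)
  then have "\<forall>j. (\<Sum>m\<in>UNIV. (cmod (X $ m $ j))\<^sup>2) = 0"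
    using assms by (simp add: sum_nonneg sum_nonneg_eq_0_iff)
  then show ?thesis
    by (simp add: sum_nonneg_eq_0_iff vec_eq_iff)
qed

text \<open>The range of \<open>E\<close> is that of the Hermitian matrix \<open>E ** hconj E\<close>, so the projection is a function of
  the latter: the indicator of the nonzero eigenvalues.\<close>

lemma orth_projection_on_range:
  fixes E :: "complex^'n^'n"
  obtains P Q where "hconj P = P" "P ** P = P" "P ** E = E" "P = E ** Q"
proof -
  have "hermitian (E ** hconj E)" by (simp add: hermitian_def hconj_mult)
  then obtain U d where U: "unitary U" and EE: "E ** hconj E = congr_diag U d"
    using spectral_theorem by blast
  note UU = unitaryD(1)[OF U]
  define P where "P = congr_diag U (\<lambda>i. if d i = 0 then 0 else 1)"
  define Q where "Q = hconj E ** congr_diag U (\<lambda>i. inverse (d i))"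
  have herm: "hconj P = P" by (simp add: P_def congr_diag_hermitian)
  have PP: "P ** P = P" by (simp add: P_def congr_diag_mult[OF UU] if_distrib cong: if_cong)
  have "E ** Q = congr_diag U (\<lambda>i. d i * inverse (d i))"
    unfolding Q_def matrix_mul_assoc EE congr_diag_mult[OF UU] ..
  moreover have "(\<lambda>i. if d i = 0 then 0 else 1) = (\<lambda>i. d i * inverse (d i))" by auto
  ultimately have "P = E ** Q" by (simp only: P_def)
  moreover have "P ** E = E"
  proof -
    define F where "F = hconj (E - P ** E)"
    have "congr_diag U (\<lambda>i. (if d i = 0 then 0 else 1) * d i) = congr_diag U d"
      by (rule arg_cong[where f = "congr_diag U"]) auto
    then have PEE: "P ** (E ** hconj E) = E ** hconj E"
      unfolding EE by (simp add: P_def congr_diag_mult[OF UU])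
    have "hconj F ** F = (E ** hconj E - P ** (E ** hconj E)) - (E ** hconj E - P ** (E ** hconj E)) ** P"
      by (simp add: F_def hconj_diff hconj_mult herm matrix_distribs matrix_mul_assoc)
    then have "hconj F ** F = 0" by (simp add: PEE)
    then have "F = 0" by (intro mult_hconj_trace_eq_0) (simp add: trace_def)
    then have "hconj F = 0" by (simp add: vec_eq_iff)
    then show ?thesis by (simp add: F_def)
  qed
  ultimately show ?thesis using that herm PP by blast
qed

text \<open>Gram--Schmidt for the columns \<open>g\<close> of \<open>K\<close>, taken in the order of \<open>r\<close>, without recursion: the
  vector belonging to \<open>i\<close> is the component of \<open>g i\<close> orthogonal to the columns of smaller rank.
  The flag they span is recorded by the oblique projections \<open>E k\<close> onto the first columns along the
  remaining ones, and by the orthogonal projections with the same ranges.\<close>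

lemma exists_flag_basis:
  fixes K K' :: "complex^'n^'n" and r :: "'n \<Rightarrow> nat"
  defines "\<iota> \<equiv> \<lambda>k i. if r i < k then 1 else (0::real)"
  defines "E \<equiv> \<lambda>k. K ** diag_real (\<iota> k) ** K'"
  assumes K: "K' ** K = mat 1" and r: "inj r"
  obtains U where "unitary U"
    "\<And>k. E k ** congr_diag U (\<iota> k) = congr_diag U (\<iota> k)"
    "\<And>k. congr_diag U (\<iota> k) ** E k = E k"
proof -
  have EE: "E a ** E b = E (min a b)" for a b
  proof -
    have "E a ** E b = K ** (diag_real (\<iota> a) ** diag_real (\<iota> b)) ** K'"
      unfolding E_def matrix_mul_assoc[symmetric]
      by (simp add: matrix_mul_assoc[of K' K] K)
    moreover have "(\<lambda>i. \<iota> a i * \<iota> b i) = \<iota> (min a b)" by (auto simp: \<iota>_def)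
    ultimately show ?thesis by (simp add: diag_real_mult E_def)
  qed
  define g where "g i = K *v axis i 1" for i
  have Eg: "E k *v g i = (if r i < k then g i else 0)" for k i
  proof -
    have "K' *v g i = axis i 1" by (simp add: g_def matrix_vector_mul_assoc K)
    then have "E k *v g i = K *v (diag_real (\<iota> k) *v axis i 1)"
      by (simp add: E_def matrix_vector_mul_assoc[symmetric])
    moreover have "diag_real (\<iota> k) *v axis i 1 = (if r i < k then axis i 1 else 0)"
      by (auto simp: vec_eq_iff diag_real_vector_nth \<iota>_def axis_def)
    ultimately show ?thesis by (simp add: g_def)
  qed
  have g0: "g i \<noteq> 0" for i
  proof
    assume "g i = 0"
    then have "K' *v g i = 0" by simp
    then show False by (simp add: g_def matrix_vector_mul_assoc K)
  qed
  have "\<exists>w. w \<noteq> 0 \<and> (\<forall>b\<le>r i. hconj (E b) *v w = 0) \<and> (\<forall>b>r i. E b *v w = w)" for i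
  proof -
    obtain P Q where P: "hconj P = P" "P ** E (r i) = E (r i)" "P = E (r i) ** Q"
      using orth_projection_on_range[of "E (r i)"] by metis
    define w where "w = g i - P *v g i"
    have "hconj (E (r i)) ** P = hconj (E (r i))" using P(1,2) by (metis hconj_mult)
    then have 0: "hconj (E (r i)) *v w = 0"
      by (simp add: w_def matrix_vector_mult_diff_distrib matrix_vector_mul_assoc)
    have "hconj (E b) *v w = 0" if "b \<le> r i" for b
    proof -
      have "hconj (E b) = hconj (E b) ** hconj (E (r i))"
        using that by (simp add: hconj_mult[symmetric] EE)
      then show ?thesis by (metis 0 matrix_vector_mul_assoc matrix_vector_mult_0_right)
    qed
    moreover have "E b *v w = w" if "r i < b" for b
    proof -
      have "E b ** P = P" using that by (simp add: P(3) matrix_mul_assoc EE)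
      then show ?thesis using that
        by (simp add: w_def matrix_vector_mult_diff_distrib matrix_vector_mul_assoc Eg)
    qed
    moreover have "w \<noteq> 0"
    proof
      assume "w = 0"
      then have "g i = E (r i) *v (Q *v g i)" by (simp add: w_def P(3) matrix_vector_mul_assoc)
      then have "E (r i) *v g i = g i" by (metis EE matrix_vector_mul_assoc min.idem)
      then show False using g0 Eg by simp
    qed
    ultimately show ?thesis by blast
  qed
  then obtain w where w0: "\<And>i. w i \<noteq> 0" and w1: "\<And>i b. b \<le> r i \<Longrightarrow> hconj (E b) *v w i = 0"
    and w2: "\<And>i b. b > r i \<Longrightarrow> E b *v w i = w i" by metis
  define u where "u i = complex_of_real (1 / norm (w i)) *s w i" for i
  have u1: "hconj (E b) *v u i = 0" if "b \<le> r i" for i b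
    using w1[OF that] by (simp add: u_def vector_scalar_commute)
  have u2: "E b *v u i = u i" if "b > r i" for i b
    using w2[OF that] by (simp add: u_def vector_scalar_commute)
  have orth: "hdot (u i) (u j) = 0" if "r i < r j" for i j
  proof -
    have "hdot (u i) (u j) = hdot (E (r j) *v u i) (u j)" using u2[OF that] by simp
    also have "\<dots> = hdot (u i) (hconj (E (r j)) *v u j)" by (simp add: hdot_matrix)
    finally show ?thesis by (simp add: u1)
  qed
  have norm1: "hdot (u i) (u i) = 1" for i
    using w0[of i] unfolding u_def hdot_smult hdot_self[of "w i"]
    by (simp add: power2_eq_square)
  have on: "hdot (u i) (u j) = (if i = j then 1 else 0)" for i j
  proof (cases "i = j")
    case False
    then have "r i < r j \<or> r j < r i" using injD[OF r, of i j] by linarith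
    then show ?thesis
      using orth[of i j] orth[of j i] hdot_commute[of "u i" "u j"] False by auto
  qed (simp add: norm1)
  define U where "U = vec_lambda (\<lambda>a. vec_lambda (\<lambda>c. u c $ a))"
  have col: "column j U = u j" for j by (simp add: column_def U_def vec_eq_iff)
  have "hconj U ** U = mat 1" by (simp add: vec_eq_iff mult_eq_hdot_columns col on mat_def)
  then have U: "unitary U" by (rule unitaryI)
  have mulU: "(A ** U) $ i $ j = (A *v u j) $ i" for A :: "complex^'n^'n" and i j
    by (simp add: matrix_matrix_mult_def matrix_vector_mult_def U_def)
  have "E k ** (U ** diag_real (\<iota> k)) = U ** diag_real (\<iota> k)" for k
    unfolding matrix_mul_assoc
    by (simp add: vec_eq_iff mult_diag_real_nth mulU) (simp add: \<iota>_def u2 U_def)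
  then have 1: "E k ** congr_diag U (\<iota> k) = congr_diag U (\<iota> k)" for k
    unfolding congr_diag_def matrix_mul_assoc by simp
  have "hconj (E k) ** (U ** diag_real (\<iota> k)) = hconj (E k) ** U" for k
    unfolding matrix_mul_assoc
    by (simp add: vec_eq_iff mult_diag_real_nth mulU) (simp add: \<iota>_def u1)
  then have "hconj (E k) ** congr_diag U (\<iota> k) = hconj (E k)" for k
    unfolding congr_diag_def
    by (metis U unitaryD(2) matrix_mul_assoc matrix_mul_rid)
  then have 2: "congr_diag U (\<iota> k) ** E k = E k" for k
    by (metis congr_diag_hermitian hconj_hconj hconj_mult)
  show ?thesis using that U 1 2 by blast
qed

lemma det_hconj: "det (hconj A) = cnj (det A)"
proof -
  have "det (hconj A) = det (\<chi> i j. cnj (A $ i $ j))"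
    by (subst det_transpose[symmetric]) (simp add: transpose_def)
  also have "\<dots> = cnj (det A)"
    by (simp add: det_def)
  finally show ?thesis .
qed

lemma det_diag_real: "det (diag_real d) = complex_of_real (\<Prod>i\<in>UNIV. d i)"
  by (subst det_diagonal) (auto simp: diag_real_nth)

lemma det_similar_diag:
  fixes K K' :: "complex^'n^'n"
  assumes "K' ** K = mat 1"
  shows "det (K ** diag_real d ** K') = complex_of_real (\<Prod>i\<in>UNIV. d i)"
proof -
  have "det K' * det K = 1" using arg_cong[OF assms, of det] by (simp add: det_mul)
  then show ?thesis by (simp add: det_mul det_diag_real mult_ac)
qed

lemma det_congr_diag:
  "unitary U \<Longrightarrow> det (congr_diag U d) = complex_of_real (\<Prod>i\<in>UNIV. d i)"
  unfolding congr_diag_def by (rule det_similar_diag[OF unitaryD(1)])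

text \<open>On an invariant subspace of \<open>T\<close> with orthogonal projection \<open>P\<close> and \<open>T\<close>-invariant oblique
  projection \<open>E\<close>, the determinant of \<open>T\<close> can be computed with either projection, because
  \<open>mat 1 + E - P\<close> is a unipotent matrix that conjugates one extension into the other.\<close>

lemma det_compression_eq:
  fixes T E P :: "complex^'n^'n"
  assumes EP: "E ** P = P" and PE: "P ** E = E" and TE: "T ** E = E ** T"
  shows "det (T ** P + (mat 1 - P)) = det (T ** E + (mat 1 - E))"
proof -
  have EE: "E ** E = E" by (metis EP PE matrix_mul_assoc)
  have PP: "P ** P = P" by (metis EP PE matrix_mul_assoc)
  define J where "J = mat 1 + (E - P)"
  have ETE: "E ** (T ** E) = T ** E" by (metis EE TE matrix_mul_assoc)
  have PTE: "P ** (T ** E) = T ** E" by (metis ETE PE matrix_mul_assoc)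
  have "J ** (mat 1 - (E - P)) = mat 1"
    by (simp add: J_def matrix_distribs EE PP EP PE)
  then have "det J * det (mat 1 - (E - P)) = 1" by (metis det_I det_mul)
  then have J0: "det J \<noteq> 0" by auto
  have "J ** (T ** E + (mat 1 - E)) = (T ** P + (mat 1 - P)) ** J"
    by (simp add: J_def matrix_distribs EE PP EP PE ETE PTE matrix_mul_assoc[symmetric])
  then have "det J * det (T ** E + (mat 1 - E)) = det (T ** P + (mat 1 - P)) * det J"
    by (metis det_mul)
  then show ?thesis using J0 by simp
qed

text \<open>Jensen's inequality for the concave logarithm, applied in an eigenbasis of the compression
  of \<open>M = hconj T ** T\<close> to the range of \<open>P\<close>: the trace of the compressed logarithm is at most the
  logarithm of the determinant of the compression.  Extending the compression by the identity off
  the range of \<open>P\<close> avoids matrices of another size.\<close>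

lemma compressed_log_trace_le:
  fixes T P W :: "complex^'n^'n"
  assumes W: "unitary W" and M: "hconj T ** T = congr_diag W (\<lambda>i. exp (z i))"
    and P: "hconj P = P" "P ** P = P" "P ** (T ** P) = T ** P"
    and det: "det (T ** P + (mat 1 - P)) = complex_of_real c" and c: "c > 0"
  shows "Re (trace (P ** congr_diag W z)) \<le> 2 * ln c"
proof -
  define R where "R = T ** P + (mat 1 - P)"
  have "invertible R" using c det by (simp add: invertible_det_nz R_def)
  then have "hconj R ** hconj (hconj R) \<in> posdef"
    using posdef_congruence[OF invertible_hconj posdef_mat_1, of R] by simp
  then obtain V n where V: "unitary V" and N: "hconj R ** R = congr_diag V (\<lambda>i. exp (n i))"
    using posdef_spectral by (metis hconj_hconj)
  have "complex_of_real (exp (\<Sum>i\<in>UNIV. n i)) = det (hconj R ** R)"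
    unfolding N det_congr_diag[OF V] by (simp add: exp_sum)
  also have "\<dots> = complex_of_real (c\<^sup>2)"
    by (simp add: det_mul det_hconj R_def det power2_eq_square)
  finally have "exp (\<Sum>i\<in>UNIV. n i) = c\<^sup>2" by (metis of_real_eq_iff)
  then have sum_n: "(\<Sum>i\<in>UNIV. n i) = 2 * ln c"
    using c by (metis ln_exp ln_realpow of_nat_numeral)
  have TP: "hconj (T ** P) ** P = hconj (T ** P)"
    using arg_cong[OF P(3), of hconj] by (simp add: hconj_mult P matrix_mul_assoc)
  have "hconj R ** R = hconj (T ** P) ** (T ** P) + (mat 1 - P)"
  proof -
    have "hconj R = hconj (T ** P) + (mat 1 - P)" by (simp add: R_def hconj_add hconj_diff P)
    then show ?thesis by (simp add: R_def matrix_distribs P TP)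
  qed
  also have "hconj (T ** P) ** (T ** P) = P ** congr_diag W (\<lambda>i. exp (z i)) ** P"
    by (simp add: hconj_mult P M[symmetric] matrix_mul_assoc)
  finally have RR: "hconj R ** R = P ** congr_diag W (\<lambda>i. exp (z i)) ** P + (mat 1 - P)" .
  define Q where "Q = hconj W ** (P ** V)"
  define Q0 where "Q0 = (mat 1 - P) ** V"
  have Qd: "hconj V ** (P ** congr_diag W d ** P) ** V = hconj Q ** diag_real d ** Q" for d
    by (simp add: Q_def congr_diag_def hconj_mult P matrix_mul_assoc)
  have Q0d: "hconj V ** (mat 1 - P) ** V = hconj Q0 ** Q0"
  proof -
    have "(mat 1 - P) ** (mat 1 - P) = mat 1 - P" by (simp add: matrix_distribs P)
    moreover have "hconj Q0 = hconj V ** (mat 1 - P)" by (simp add: Q0_def hconj_mult hconj_diff P)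
    ultimately show ?thesis
      unfolding Q0_def by (metis (no_types) matrix_mul_assoc)
  qed
  have entry: "(\<Sum>m\<in>UNIV. (cmod (Q $ m $ j))\<^sup>2 * z m) \<le> n j" for j
  proof -
    let ?q = "\<lambda>m. (cmod (Q $ m $ j))\<^sup>2" and ?rest = "\<Sum>m\<in>UNIV. (cmod (Q0 $ m $ j))\<^sup>2"
    have q0: "Re ((hconj Q0 ** Q0) $ j $ j) = ?rest"
      using quadratic_form_diag[of Q0 "\<lambda>i. 1" j] by (simp add: diag_real_one)
    have "hconj V ** (hconj R ** R) ** V = diag_real (\<lambda>i. exp (n i))"
    proof -
      have "hconj V ** (hconj R ** R) ** V
          = (hconj V ** V) ** diag_real (\<lambda>i. exp (n i)) ** (hconj V ** V)"
        unfolding N congr_diag_def matrix_mul_assoc ..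
      then show ?thesis by (simp add: unitaryD[OF V])
    qed
    moreover have "hconj V ** (hconj R ** R) ** V
        = hconj Q ** diag_real (\<lambda>i. exp (z i)) ** Q + hconj Q0 ** Q0"
      unfolding RR matrix_add_ldistrib matrix_add_rdistrib Qd Q0d ..
    ultimately have "(hconj Q ** diag_real (\<lambda>i. exp (z i)) ** Q + hconj Q0 ** Q0) $ j $ j
        = complex_of_real (exp (n j))"
      by (simp add: diag_real_nth)
    then have "exp (n j) = Re ((hconj Q ** diag_real (\<lambda>i. exp (z i)) ** Q) $ j $ j) + ?rest"
      unfolding vector_add_component q0[symmetric]
      by (metis Re_complex_of_real plus_complex.sel(1))
    then have e: "exp (n j) = (\<Sum>m\<in>UNIV. ?q m * exp (z m)) + ?rest"
      by (simp add: quadratic_form_diag)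
    have "hconj Q ** diag_real (\<lambda>i. 1) ** Q + hconj Q0 ** Q0 = mat 1"
    proof -
      have "hconj Q ** diag_real (\<lambda>i. 1) ** Q + hconj Q0 ** Q0
          = hconj V ** (P ** congr_diag W (\<lambda>i. 1) ** P + (mat 1 - P)) ** V"
        unfolding matrix_add_ldistrib matrix_add_rdistrib Qd Q0d ..
      then show ?thesis by (simp add: congr_diag_unitary_one[OF W] P unitaryD[OF V])
    qed
    then have "(hconj Q ** diag_real (\<lambda>i. 1) ** Q + hconj Q0 ** Q0) $ j $ j = 1"
      by (simp only:) (simp add: mat_def)
    then have "1 = Re ((hconj Q ** diag_real (\<lambda>i. 1) ** Q) $ j $ j) + ?rest"
      unfolding vector_add_component q0[symmetric]
      by (metis one_complex.sel(1) plus_complex.sel(1))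
    then have one: "1 = (\<Sum>m\<in>UNIV. ?q m) + ?rest"
      by (simp add: quadratic_form_diag)
    \<comment> \<open>tangent to the logarithm at \<open>exp (n j)\<close>\<close>
    have tan: "t \<le> exp t * exp (- n j) - 1 + n j" for t
      using exp_ge_add_one_self[of "t - n j"] by (simp add: exp_diff exp_minus field_simps)
    have "(\<Sum>m\<in>UNIV. ?q m * z m) + ?rest * 0
        \<le> (\<Sum>m\<in>UNIV. ?q m * (exp (z m) * exp (- n j) - 1 + n j)) + ?rest * (exp 0 * exp (- n j) - 1 + n j)"
      by (intro add_mono sum_mono mult_left_mono tan sum_nonneg) auto
    also have "\<dots> = ((\<Sum>m\<in>UNIV. ?q m * exp (z m)) + ?rest) * exp (- n j) + ((\<Sum>m\<in>UNIV. ?q m) + ?rest) * (n j - 1)"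
      by (simp add: sum_distrib_right sum_distrib_left sum.distrib algebra_simps sum_subtractf)
    also have "\<dots> = n j"
      unfolding e[symmetric] one[symmetric] by (simp add: exp_minus)
    finally show ?thesis by simp
  qed
  have "trace (P ** congr_diag W z) = trace (P ** congr_diag W z ** P)"
    using trace_mul_sym[of "P ** congr_diag W z" P] by (simp add: P matrix_mul_assoc)
  also have "\<dots> = trace (P ** congr_diag W z ** P ** (V ** hconj V))"
    by (simp add: unitaryD[OF V])
  also have "\<dots> = trace (hconj V ** (P ** congr_diag W z ** P) ** V)"
    using trace_mul_sym[of "P ** congr_diag W z ** P ** V" "hconj V"] by (simp add: matrix_mul_assoc)
  finally have "Re (trace (P ** congr_diag W z)) = (\<Sum>j\<in>UNIV. \<Sum>m\<in>UNIV. (cmod (Q $ m $ j))\<^sup>2 * z m)"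
    unfolding Qd by (simp add: trace_def quadratic_form_diag)
  also have "\<dots> \<le> (\<Sum>j\<in>UNIV. n j)" by (intro sum_mono entry)
  finally show ?thesis by (simp add: sum_n)
qed

text \<open>The eigenvalues \<open>exp \<nu>\<close> of \<open>T\<close> are log-majorised by its singular values \<open>exp (z / 2)\<close>.  In an
  orthonormal basis adapted to the flag of eigenvectors of \<open>T\<close>, sorted by eigenvalue, the partial
  sums of the diagonal of \<open>log (hconj T ** T)\<close> are bounded by the logarithms of the determinants of
  the restrictions of \<open>T\<close>; Abel summation against the increasing derivative of the power turns this
  into the first order condition needed in Klein's inequality.  Equality forces
  \<open>Tr (hconj T ** T) = Tr (T ** T)\<close>, hence \<open>T\<close> is Hermitian.\<close>

theorem weyl_power_inequality:
  fixes T K K' W :: "complex^'n^'n"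
  assumes KK: "K' ** K = mat 1" and T: "T = K ** diag_real (\<lambda>i. exp (\<nu> i)) ** K'"
    and W: "unitary W" and M: "hconj T ** T = congr_diag W (\<lambda>i. exp (z i))"
    and p: "p > 1"
  shows "(\<Sum>i\<in>UNIV. \<bar>2 * \<nu> i\<bar> powr p) \<le> (\<Sum>i\<in>UNIV. \<bar>z i\<bar> powr p)"
    and "hconj T \<noteq> T \<Longrightarrow> (\<Sum>i\<in>UNIV. \<bar>2 * \<nu> i\<bar> powr p) < (\<Sum>i\<in>UNIV. \<bar>z i\<bar> powr p)"
proof -
  define x where "x i = 2 * \<nu> i" for i
  obtain r :: "'n \<Rightarrow> nat" where r: "inj r" and rx: "\<And>i j. r i < r j \<Longrightarrow> x i \<le> x j"
    using exists_sorting_rank[of x] by blast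
  define \<iota> where "\<iota> k i = (if r i < k then 1 else (0::real))" for k i
  define E where "E k = K ** diag_real (\<iota> k) ** K'" for k
  obtain U where U: "unitary U" and EP: "\<And>k. E k ** congr_diag U (\<iota> k) = congr_diag U (\<iota> k)"
    and PE: "\<And>k. congr_diag U (\<iota> k) ** E k = E k"
    using exists_flag_basis[OF KK r] unfolding E_def \<iota>_def[abs_def] by blast
  have similar: "(K ** diag_real a ** K') ** (K ** diag_real b ** K') = K ** diag_real (\<lambda>i. a i * b i) ** K'"
    for a b
  proof -
    have "(K ** diag_real a ** K') ** (K ** diag_real b ** K')
        = K ** diag_real a ** (K' ** K) ** diag_real b ** K'" by (simp only: matrix_mul_assoc)
    then show ?thesis by (simp add: KK matrix_mul_assoc[symmetric] diag_real_mult_left)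
  qed
  define L where "L = congr_diag W z"
  define l where "l i = Re ((hconj U ** L ** U) $ i $ i)" for i
  define s where "s i j = (cmod ((hconj W ** U) $ j $ i))\<^sup>2" for i j
  have WU: "unitary (hconj W ** U)" by (intro unitary_mult unitary_hconj U W)
  have ls: "l i = (\<Sum>j\<in>UNIV. s i j * z j)" for i
    using quadratic_form_diag[of "hconj W ** U" z i]
    by (simp add: l_def L_def s_def congr_diag_def hconj_mult matrix_mul_assoc)
  have row: "(\<Sum>j\<in>UNIV. s i j) = 1" for i
    using unitary_column_sum[OF unitaryD(1)[OF WU], of i] by (simp add: s_def)
  have col: "(\<Sum>i\<in>UNIV. s i j) = 1" for j
    using unitary_row_sum[OF WU, of j] by (simp add: s_def)
  have part: "(\<Sum>i | r i < k. l i - x i) \<le> 0" for k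
  proof -
    let ?P = "congr_diag U (\<iota> k)"
    have PP: "?P ** ?P = ?P" by (metis EP PE matrix_mul_assoc)
    have TE: "T ** E k = E k ** T" by (simp add: T E_def similar mult.commute)
    have PTP: "?P ** (T ** ?P) = T ** ?P"
    proof -
      have "T ** ?P = T ** E k ** ?P" by (simp add: EP matrix_mul_assoc[symmetric])
      also have "\<dots> = E k ** (T ** ?P)" by (simp add: TE matrix_mul_assoc)
      finally have *: "T ** ?P = E k ** (T ** ?P)" .
      have "?P ** (T ** ?P) = ?P ** (E k ** (T ** ?P))" using * by simp
      also have "\<dots> = E k ** (T ** ?P)" by (simp add: matrix_mul_assoc PE)
      finally show ?thesis using * by simp
    qed
    have one: "mat 1 = K ** diag_real (\<lambda>i. 1) ** K'"
      using KK by (simp add: diag_real_one matrix_left_right_inverse)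
    have "T ** E k + (mat 1 - E k) = K ** diag_real (\<lambda>i. if r i < k then exp (\<nu> i) else 1) ** K'"
    proof -
      have "T ** E k + (mat 1 - E k) = K ** (diag_real (\<lambda>i. exp (\<nu> i) * \<iota> k i) +
          (diag_real (\<lambda>i. 1) - diag_real (\<iota> k))) ** K'"
        by (subst one) (simp add: T E_def similar matrix_distribs)
      also have "diag_real (\<lambda>i. exp (\<nu> i) * \<iota> k i) + (diag_real (\<lambda>i. 1) - diag_real (\<iota> k))
          = diag_real (\<lambda>i. if r i < k then exp (\<nu> i) else 1)"
        by (simp add: vec_eq_iff diag_real_nth \<iota>_def)
      finally show ?thesis .
    qed
    then have "det (T ** ?P + (mat 1 - ?P)) = complex_of_real (\<Prod>i\<in>UNIV. if r i < k then exp (\<nu> i) else 1)"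
      using det_compression_eq[OF EP PE TE] det_similar_diag[OF KK] by metis
    also have "(\<Prod>i\<in>UNIV. if r i < k then exp (\<nu> i) else 1) = exp (\<Sum>i | r i < k. \<nu> i)"
      by (simp add: exp_sum prod.If_cases)
    finally have "Re (trace (?P ** L)) \<le> 2 * ln (exp (\<Sum>i | r i < k. \<nu> i))"
      unfolding L_def by (intro compressed_log_trace_le[OF W M _ PP PTP]) (auto simp: congr_diag_hermitian)
    also have "\<dots> = (\<Sum>i | r i < k. x i)" by (simp add: x_def sum_distrib_left)
    also have "Re (trace (?P ** L)) = (\<Sum>i | r i < k. l i)"
    proof -
      have "trace (?P ** L) = trace (diag_real (\<iota> k) ** (hconj U ** L ** U))"
        using trace_mul_sym[of U "diag_real (\<iota> k) ** hconj U ** L"]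
        by (simp add: congr_diag_def matrix_mul_assoc)
      then have "Re (trace (?P ** L)) = (\<Sum>i\<in>UNIV. if r i < k then l i else 0)"
        by (auto simp: trace_def diag_real_mult_nth l_def \<iota>_def intro!: sum.cong)
      then show ?thesis by (simp add: sum.If_cases)
    qed
    finally show ?thesis by (simp add: sum_subtractf)
  qed
  have total: "(\<Sum>i\<in>UNIV. l i - x i) = 0"
  proof -
    have "complex_of_real (exp (\<Sum>i\<in>UNIV. z i)) = det (hconj T ** T)"
      unfolding M det_congr_diag[OF W] by (simp add: exp_sum)
    also have "\<dots> = complex_of_real ((exp (\<Sum>i\<in>UNIV. \<nu> i))\<^sup>2)"
      using det_similar_diag[OF KK, of "\<lambda>i. exp (\<nu> i)"]
      by (simp add: det_mul[of "hconj T"] det_hconj T[symmetric] exp_sum power2_eq_square)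
    finally have "exp (\<Sum>i\<in>UNIV. z i) = exp (2 * (\<Sum>i\<in>UNIV. \<nu> i))"
      by (simp only: of_real_eq_iff exp_double)
    then have "(\<Sum>i\<in>UNIV. z i) = (\<Sum>i\<in>UNIV. x i)" by (simp add: x_def sum_distrib_left)
    moreover have "(\<Sum>i\<in>UNIV. l i) = (\<Sum>j\<in>UNIV. z j)"
      unfolding ls by (subst sum.swap) (simp add: sum_distrib_right[symmetric] col)
    ultimately show ?thesis by (simp add: sum_subtractf)
  qed
  have first_order: "(\<Sum>i\<in>UNIV. abs_powr_deriv p (x i) * (l i - x i)) \<ge> 0"
    using abel_summation_le[OF r _ part total, of "\<lambda>i. abs_powr_deriv p (x i)"]
      abs_powr_deriv_mono[OF p] rx by blast
  have s0: "s i j \<ge> 0" for i j by (simp add: s_def)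
  note klein = klein_inequality[where s = s and x = x and z = z, OF p s0 row col, folded ls]
  show "(\<Sum>i\<in>UNIV. \<bar>2 * \<nu> i\<bar> powr p) \<le> (\<Sum>i\<in>UNIV. \<bar>z i\<bar> powr p)"
    using klein(1) first_order by (simp add: x_def)
  assume nonherm: "hconj T \<noteq> T"
  have "\<exists>a b. s a b \<noteq> 0 \<and> z b \<noteq> x a"
  proof (rule ccontr)
    assume "\<not> ?thesis"
    then have sx: "s i j * exp (z j) = s i j * exp (x i)" for i j by (cases "s i j = 0") auto
    have "(\<Sum>j\<in>UNIV. s i j * exp (z j)) = exp (x i)" for i
      unfolding sx sum_distrib_right[symmetric] by (simp add: row)
    then have "(\<Sum>i\<in>UNIV. exp (x i)) = (\<Sum>i\<in>UNIV. \<Sum>j\<in>UNIV. s i j * exp (z j))" by simp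
    also have "\<dots> = (\<Sum>j\<in>UNIV. exp (z j))"
      by (subst sum.swap) (simp add: sum_distrib_right[symmetric] col)
    finally have eq: "trace (hconj T ** T) = complex_of_real (\<Sum>i\<in>UNIV. exp (x i))"
      by (simp add: M trace_congr_diag[OF W])
    have "trace (T ** T) = trace (K' ** (K ** diag_real (\<lambda>i. exp (\<nu> i) * exp (\<nu> i))))"
      unfolding T similar by (rule trace_mul_sym)
    also have "\<dots> = complex_of_real (\<Sum>i\<in>UNIV. exp (x i))"
      by (simp add: KK matrix_mul_assoc trace_def diag_real_nth x_def exp_add[symmetric])
    finally have eq2: "trace (T ** T) = trace (hconj T ** T)" by (simp add: eq)
    have "trace (hconj T ** hconj T) = cnj (trace (T ** T))"
      by (simp add: hconj_mult[symmetric] trace_def)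
    then have eq3: "trace (hconj T ** hconj T) = trace (hconj T ** T)" by (simp add: eq2 eq)
    have "hconj (T - hconj T) ** (T - hconj T) = hconj T ** T - hconj T ** hconj T - T ** T + T ** hconj T"
      by (simp add: hconj_diff matrix_distribs)
    then have "trace (hconj (T - hconj T) ** (T - hconj T))
        = trace (hconj T ** T) - trace (hconj T ** hconj T) - trace (T ** T) + trace (T ** hconj T)"
      by (simp add: trace_add trace_sub)
    also have "trace (T ** hconj T) = trace (hconj T ** T)" by (rule trace_mul_sym)
    finally have "trace (hconj (T - hconj T) ** (T - hconj T)) = 0" by (simp add: eq2 eq3)
    then have "T - hconj T = 0" by (intro mult_hconj_trace_eq_0) simp
    then show False using nonherm by simp
  qed
  then show "(\<Sum>i\<in>UNIV. \<bar>2 * \<nu> i\<bar> powr p) < (\<Sum>i\<in>UNIV. \<bar>z i\<bar> powr p)"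
    using klein(2) first_order by (fastforce simp: x_def)
qed

section \<open>The exponential metric increasing property\<close>

lemma posdef_gram:
  fixes R :: "complex^'n^'n"
  assumes "invertible R"
  shows "hconj R ** R \<in> posdef"
  using posdef_congruence[OF invertible_hconj[OF assms] posdef_mat_1] by simp

text \<open>With \<open>T = Q ** inverse P\<close>, the distance of \<open>P\<close> and \<open>Q\<close> is governed by the eigenvalues of \<open>T\<close>
  and that of their squares by the singular values of \<open>T\<close>, so Weyl's inequality says that geodesics
  issuing from the identity spread apart at least linearly.\<close>

theorem pd_dist_square:
  fixes P Q :: "complex^'n^'n"
  assumes P: "P \<in> posdef" and Q: "Q \<in> posdef" and p: "p > 1"
  shows "2 powr p * pd_dist p P Q powr p \<le> pd_dist p (P ** P) (Q ** Q) powr p"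
    and "P ** Q \<noteq> Q ** P \<Longrightarrow> 2 powr p * pd_dist p P Q powr p < pd_dist p (P ** P) (Q ** Q) powr p"
proof -
  obtain K \<nu> where K: "invertible K" and PK: "P = K ** hconj K"
    and QK: "Q = congr_diag K (\<lambda>i. exp (\<nu> i))"
    using posdef_simultaneous_diag[OF P Q] .
  obtain K' where K': "K ** K' = mat 1" "K' ** K = mat 1" using K by (auto simp: invertible_def)
  define P' where "P' = hconj K' ** K'"
  have KhK': "hconj K ** hconj K' = mat 1" by (simp add: hconj_mult[symmetric] K')
  have PP': "P ** P' = mat 1"
    unfolding PK P'_def by (simp add: matrix_mult_cancel_mid KhK' K')
  then have P'P: "P' ** P = mat 1" by (simp add: matrix_left_right_inverse)
  have herm: "hconj P = P" "hconj Q = Q" "hconj P' = P'"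
    by (simp_all add: PK QK P'_def hconj_mult congr_diag_hermitian)
  define T where "T = Q ** P'"
  have T: "T = K ** diag_real (\<lambda>i. exp (\<nu> i)) ** K'"
    unfolding T_def QK P'_def congr_diag_def by (simp add: matrix_mult_cancel_mid KhK')
  have "det T \<noteq> 0"
    unfolding T det_similar_diag[OF K'(2)] by simp
  then have "hconj T ** T \<in> posdef" by (simp add: posdef_gram invertible_det_nz)
  then obtain W z where W: "unitary W" and M: "hconj T ** T = congr_diag W (\<lambda>i. exp (z i))"
    by (rule posdef_spectral)
  have hT: "hconj T = P' ** Q" by (simp add: T_def hconj_mult herm)
  define S where "S = P ** W"
  have invP: "invertible P" using PP' P'P by (auto simp: invertible_def)
  have S: "invertible S" by (simp add: S_def invertible_mult invP unitary_invertible W)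
  have "P ** P = S ** hconj S"
    unfolding S_def hconj_mult by (simp add: matrix_mult_cancel_mid unitaryD[OF W] herm)
  moreover have "Q ** Q = congr_diag S (\<lambda>i. exp (z i))"
  proof -
    have "congr_diag S (\<lambda>i. exp (z i)) = P ** (hconj T ** T) ** P"
      unfolding S_def M using congr_diag_congr[of P W "\<lambda>i. exp (z i)"] by (simp add: herm)
    also have "\<dots> = (P ** P') ** (Q ** Q) ** (P' ** P)"
      unfolding hT by (simp only: T_def matrix_mul_assoc)
    finally show ?thesis by (simp add: PP' P'P)
  qed
  ultimately have sq: "pd_dist p (P ** P) (Q ** Q) powr p = (\<Sum>i\<in>UNIV. \<bar>z i\<bar> powr p)"
    using pd_dist_congr_diag[OF S, of p z] p by simp
  have one: "2 powr p * pd_dist p P Q powr p = (\<Sum>i\<in>UNIV. \<bar>2 * \<nu> i\<bar> powr p)"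
    using pd_dist_congr_diag[OF K, of p \<nu>] p
    by (simp add: PK QK abs_mult powr_mult sum_distrib_left)
  show "2 powr p * pd_dist p P Q powr p \<le> pd_dist p (P ** P) (Q ** Q) powr p"
    unfolding sq one by (rule weyl_power_inequality(1)[OF K'(2) T W M p])
  assume nc: "P ** Q \<noteq> Q ** P"
  have "hconj T \<noteq> T"
  proof
    assume "hconj T = T"
    then have "P' ** Q = Q ** P'" using hT T_def by metis
    then have "P ** (P' ** Q) ** P = P ** (Q ** P') ** P" by simp
    then have "(P ** P') ** Q ** P = P ** Q ** (P' ** P)" by (simp only: matrix_mul_assoc)
    then show False using nc by (simp add: PP' P'P)
  qed
  then show "2 powr p * pd_dist p P Q powr p < pd_dist p (P ** P) (Q ** Q) powr p"
    unfolding sq one by (rule weyl_power_inequality(2)[OF K'(2) T W M p])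
qed

definition exp_group :: "complex^'n^'n \<Rightarrow> ('n \<Rightarrow> real) \<Rightarrow> real \<Rightarrow> complex^'n^'n" where
  "exp_group U x t = congr_diag U (\<lambda>i. exp (t * x i))"

lemma exp_group_add:
  "unitary U \<Longrightarrow> exp_group U x s ** exp_group U x t = exp_group U x (s + t)"
  by (simp add: exp_group_def congr_diag_mult unitaryD exp_add[symmetric] distrib_right)

lemma exp_group_0: "unitary U \<Longrightarrow> exp_group U x 0 = mat 1"
  by (simp add: exp_group_def congr_diag_unitary_one)

lemma exp_group_hermitian: "hconj (exp_group U x t) = exp_group U x t"
  by (simp add: exp_group_def congr_diag_hermitian)

lemma exp_group_posdef: "unitary U \<Longrightarrow> exp_group U x t \<in> posdef"
  by (simp add: exp_group_def posdef_congr_diag unitary_invertible)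

lemma congr_diag_scaleR: "congr_diag S (\<lambda>i. c * d i) = c *\<^sub>R congr_diag S d"
  unfolding congr_diag_def
  by (simp add: vec_eq_iff matrix_matrix_mult_def[of "S ** _"] mult_diag_real_nth
      scaleR_conv_of_real[of _ "_ :: complex"] sum_distrib_left mult_ac)

lemma exp_group_has_derivative_0:
  "(exp_group U (\<lambda>i. c * x i) has_vector_derivative congr_diag U (\<lambda>i. c * x i)) (at 0)"
proof -
  define D where "D i = congr_diag U (\<lambda>j. if j = i then 1 else 0)" for i
  have sum: "congr_diag U d = (\<Sum>i\<in>UNIV. d i *\<^sub>R D i)" for d
  proof -
    have "D i $ a $ b = (\<Sum>k\<in>UNIV. if k = i then U $ a $ k * cnj (U $ b $ k) else 0)" for i a b
      unfolding D_def congr_diag_def matrix_matrix_mult_def[of "U ** _"] vec_lambda_beta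
      by (rule sum.cong) (auto simp: mult_diag_real_nth)
    then have "(\<Sum>i\<in>UNIV. d i *\<^sub>R D i) $ a $ b
        = (\<Sum>i\<in>UNIV. complex_of_real (d i) * (U $ a $ i * cnj (U $ b $ i)))" for a b
      by (simp add: scaleR_conv_of_real[of _ "_ :: complex"])
    moreover have "congr_diag U d $ a $ b
        = (\<Sum>i\<in>UNIV. complex_of_real (d i) * (U $ a $ i * cnj (U $ b $ i)))" for a b
      by (simp add: congr_diag_def matrix_matrix_mult_def[of "U ** _"] mult_diag_real_nth mult_ac)
    ultimately show ?thesis by (simp add: vec_eq_iff)
  qed
  have "((\<lambda>t. \<Sum>i\<in>UNIV. exp (t * (c * x i)) *\<^sub>R D i) has_vector_derivative
      (\<Sum>i\<in>UNIV. (c * x i) *\<^sub>R D i)) (at 0)"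
    by (auto intro!: derivative_eq_intros has_vector_derivative_sum)
  then show ?thesis unfolding exp_group_def[abs_def] sum .
qed

lemma bounded_bilinear_matrix_mult:
  "bounded_bilinear (\<lambda>A B. A ** B :: complex^'n^'n)"
  unfolding bilinear_conv_bounded_bilinear[symmetric] bilinear_def
  by (auto intro!: linearI simp: matrix_distribs)
    (auto simp: vec_eq_iff matrix_matrix_mult_def scaleR_sum_right)


text \<open>For \<open>t > 0\<close> the distance of \<open>exp (t X)\<close> and \<open>exp (t Y)\<close> is the norm of the logarithm of
  \<open>M t = exp (- t X / 2) exp (t Y) exp (- t X / 2)\<close>.  Klein's inequality at the difference of the
  generators only involves the diagonal of \<open>log (M t) / t\<close> in a fixed eigenbasis, and there
  \<open>1 - 1/m \<le> ln m \<le> m - 1\<close> encloses it between difference quotients of the diagonal of \<open>M\<close> at 0;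
  the lower one uses \<open>M (- t)\<close>, which is the inverse of \<open>M t\<close>.\<close>

lemma pd_dist_exp_group_klein:
  fixes U V F :: "complex^'n^'n" and x y h :: "'n \<Rightarrow> real"
  assumes U: "unitary U" and V: "unitary V" and F: "unitary F" and p: "p > 1" and t: "t > 0"
  defines "M \<equiv> \<lambda>t. exp_group U (\<lambda>i. - 1 / 2 * x i) t ** exp_group V y t ** exp_group U (\<lambda>i. - 1 / 2 * x i) t"
  defines "g \<equiv> \<lambda>i t. Re ((hconj F ** M t ** F) $ i $ i)"
  obtains c where
    "(\<Sum>i\<in>UNIV. \<bar>h i\<bar> powr p) + (\<Sum>i\<in>UNIV. abs_powr_deriv p (h i) * (c i - h i))
      \<le> (1 / t) powr p * pd_dist p (exp_group U x t) (exp_group V y t) powr p"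
    "\<And>i. (1 - g i (- t)) / t \<le> c i" "\<And>i. c i \<le> (g i t - 1) / t"
proof -
  have half: "exp_group U (\<lambda>i. - 1 / 2 * x i) s = exp_group U x (- s / 2)" for s
    by (simp add: exp_group_def)
  have Meq: "M s = exp_group U x (- s / 2) ** exp_group V y s ** hconj (exp_group U x (- s / 2))" for s
    by (simp only: M_def half exp_group_hermitian)
  have inv: "invertible (exp_group U x s)" for s
    using exp_group_add[OF U, of x s "- s"] exp_group_add[OF U, of x "- s" s] exp_group_0[OF U, of x]
    unfolding invertible_def by auto
  have "M t \<in> posdef"
    unfolding Meq by (rule posdef_congruence[OF inv exp_group_posdef[OF V]])
  then obtain W z where W: "unitary W" and Mt: "M t = congr_diag W (\<lambda>i. exp (z i))"
    by (rule posdef_spectral)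
  have Mmt: "M (- t) = congr_diag W (\<lambda>i. exp (- z i))"
  proof -
    have "M (- t) ** M t = exp_group U x (t / 2) ** exp_group V y (- t)
        ** (exp_group U x (t / 2) ** exp_group U x (- t / 2)) ** exp_group V y t ** exp_group U x (- t / 2)"
      unfolding M_def half matrix_mul_assoc by simp
    also have "\<dots> = exp_group U x (t / 2) ** (exp_group V y (- t) ** exp_group V y t) ** exp_group U x (- t / 2)"
      by (simp add: exp_group_add[OF U] exp_group_0[OF U] matrix_mul_assoc)
    also have "\<dots> = mat 1"
      by (simp add: exp_group_add[OF U] exp_group_0[OF U] exp_group_add[OF V] exp_group_0[OF V])
    finally have 1: "M (- t) ** M t = mat 1" .
    have 2: "M t ** congr_diag W (\<lambda>i. exp (- z i)) = mat 1"
      unfolding Mt congr_diag_mult[OF unitaryD(1)[OF W]]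
      by (simp add: exp_add[symmetric] congr_diag_unitary_one[OF W])
    have "M (- t) = M (- t) ** (M t ** congr_diag W (\<lambda>i. exp (- z i)))" by (simp add: 2)
    also have "\<dots> = congr_diag W (\<lambda>i. exp (- z i))" by (simp add: matrix_mul_assoc 1)
    finally show ?thesis .
  qed
  define S where "S = exp_group U x (t / 2) ** W"
  have S: "invertible S" by (simp add: S_def invertible_mult inv unitary_invertible W)
  have "exp_group U x t = S ** hconj S"
    unfolding S_def hconj_mult exp_group_hermitian
    by (simp add: matrix_mult_cancel_mid unitaryD[OF W] exp_group_add[OF U])
  moreover have "exp_group V y t = congr_diag S (\<lambda>i. exp (z i))"
  proof -
    have "congr_diag S (\<lambda>i. exp (z i)) = exp_group U x (t / 2) ** M t ** exp_group U x (t / 2)"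
      unfolding S_def Mt congr_diag_congr[symmetric] by (simp add: exp_group_hermitian)
    also have "\<dots> = (exp_group U x (t / 2) ** exp_group U x (- t / 2)) ** exp_group V y t
        ** (exp_group U x (- t / 2) ** exp_group U x (t / 2))"
      by (simp only: M_def half matrix_mul_assoc)
    finally show ?thesis by (simp add: exp_group_add[OF U] exp_group_0[OF U])
  qed
  ultimately have dist: "pd_dist p (exp_group U x t) (exp_group V y t) powr p = (\<Sum>i\<in>UNIV. \<bar>z i\<bar> powr p)"
    using pd_dist_congr_diag[OF S, of p z] p by simp
  define s where "s i j = (cmod ((hconj W ** F) $ j $ i))\<^sup>2" for i j
  have WF: "unitary (hconj W ** F)" by (intro unitary_mult unitary_hconj F W)
  have s0: "s i j \<ge> 0" for i j by (simp add: s_def)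
  have row: "(\<Sum>j\<in>UNIV. s i j) = 1" for i
    using unitary_column_sum[OF unitaryD(1)[OF WF], of i] by (simp add: s_def)
  have col: "(\<Sum>i\<in>UNIV. s i j) = 1" for j
    using unitary_row_sum[OF WF, of j] by (simp add: s_def)
  have quad: "Re ((hconj F ** congr_diag W d ** F) $ i $ i) = (\<Sum>j\<in>UNIV. s i j * d j)" for d i
    using quadratic_form_diag[of "hconj W ** F" d i]
    by (simp add: s_def congr_diag_def hconj_mult matrix_mul_assoc)
  define c where "c i = (\<Sum>j\<in>UNIV. s i j * (z j / t))" for i
  have ct: "c i = (\<Sum>j\<in>UNIV. s i j * z j) / t" for i
    by (simp add: c_def sum_divide_distrib)
  have shift: "(\<Sum>j\<in>UNIV. s i j * d j) + k = (\<Sum>j\<in>UNIV. s i j * (d j + k))" for i d k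
    by (simp add: distrib_left sum.distrib sum_distrib_right[symmetric] row)
  have "c i \<le> (g i t - 1) / t" for i
  proof -
    have "z j \<le> exp (z j) + (- 1)" for j using exp_ge_add_one_self[of "z j"] by linarith
    then have "(\<Sum>j\<in>UNIV. s i j * z j) \<le> (\<Sum>j\<in>UNIV. s i j * (exp (z j) + (- 1)))"
      by (intro sum_mono mult_left_mono s0)
    then have "(\<Sum>j\<in>UNIV. s i j * z j) \<le> g i t - 1"
      unfolding g_def Mt quad shift[symmetric] by simp
    then show ?thesis unfolding ct using t by (simp add: divide_right_mono)
  qed
  moreover have "(1 - g i (- t)) / t \<le> c i" for i
  proof -
    have "- z j \<le> exp (- z j) + (- 1)" for j using exp_ge_add_one_self[of "- z j"] by linarith
    then have "(\<Sum>j\<in>UNIV. s i j * (- z j)) \<le> (\<Sum>j\<in>UNIV. s i j * (exp (- z j) + (- 1)))"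
      by (intro sum_mono mult_left_mono s0)
    then have "1 - g i (- t) \<le> (\<Sum>j\<in>UNIV. s i j * z j)"
      unfolding g_def Mmt quad shift[symmetric] by (simp add: sum_negf)
    then show ?thesis unfolding ct using t by (simp add: divide_right_mono)
  qed
  moreover have "(1 / t) powr p * (\<Sum>i\<in>UNIV. \<bar>z i\<bar> powr p) = (\<Sum>i\<in>UNIV. \<bar>z i / t\<bar> powr p)"
    using t by (simp add: sum_distrib_left abs_divide powr_mult[symmetric])
  then have "(\<Sum>i\<in>UNIV. \<bar>h i\<bar> powr p) + (\<Sum>i\<in>UNIV. abs_powr_deriv p (h i) * (c i - h i))
      \<le> (1 / t) powr p * pd_dist p (exp_group U x t) (exp_group V y t) powr p"
    using klein_inequality(1)[where s = s and x = h and z = "\<lambda>j. z j / t", OF p s0 row col]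
    by (simp add: dist c_def)
  ultimately show ?thesis using that by blast
qed

lemma conjugated_exp_groups_derivative:
  fixes U V F :: "complex^'n^'n" and x y h :: "'n \<Rightarrow> real"
  assumes U: "unitary U" and V: "unitary V" and F: "unitary F"
    and H: "congr_diag V y - congr_diag U x = congr_diag F h"
  defines "M \<equiv> \<lambda>t. exp_group U (\<lambda>i. - 1 / 2 * x i) t ** exp_group V y t ** exp_group U (\<lambda>i. - 1 / 2 * x i) t"
  defines "g \<equiv> \<lambda>i t. Re ((hconj F ** M t ** F) $ i $ i)"
  shows "((\<lambda>t. (g i t - 1) / t) \<longlongrightarrow> h i) (at 0)"
proof -
  let ?X = "congr_diag U (\<lambda>i. - 1 / 2 * x i)"
  have half: "?X + ?X = - congr_diag U x"
    using congr_diag_scaleR[of U "-1" x] by (simp add: congr_diag_add)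
  have dU: "(exp_group U (\<lambda>i. - 1 / 2 * x i) has_vector_derivative ?X) (at 0)"
    by (rule exp_group_has_derivative_0)
  have dV: "(exp_group V y has_vector_derivative congr_diag V y) (at 0)"
    using exp_group_has_derivative_0[of V 1 y] by simp
  have "(M has_vector_derivative
      (exp_group U (\<lambda>i. - 1 / 2 * x i) 0 ** exp_group V y 0) ** ?X
      + (exp_group U (\<lambda>i. - 1 / 2 * x i) 0 ** congr_diag V y + ?X ** exp_group V y 0)
        ** exp_group U (\<lambda>i. - 1 / 2 * x i) 0) (at 0)"
    unfolding M_def
    by (rule bounded_bilinear.has_vector_derivative[OF bounded_bilinear_matrix_mult
          bounded_bilinear.has_vector_derivative[OF bounded_bilinear_matrix_mult dU dV] dU])
  then have dM: "(M has_vector_derivative congr_diag F h) (at 0)"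
    using half by (simp add: exp_group_0[OF U] exp_group_0[OF V] H[symmetric] algebra_simps)
  define \<phi> where "\<phi> A = Re ((hconj F ** A ** F) $ i $ i)" for A
  have "linear \<phi>"
    by (rule linearI)
      (simp_all add: \<phi>_def matrix_distribs bounded_bilinear.scaleR_left[OF bounded_bilinear_matrix_mult]
        bounded_bilinear.scaleR_right[OF bounded_bilinear_matrix_mult])
  then have "bounded_linear \<phi>" by (simp add: linear_conv_bounded_linear)
  from bounded_linear.has_vector_derivative[OF this dM]
  have "((\<lambda>t. g i t) has_vector_derivative \<phi> (congr_diag F h)) (at 0)"
    by (simp add: g_def \<phi>_def)
  moreover have "\<phi> (congr_diag F h) = h i"
  proof -
    have "hconj F ** congr_diag F h ** F = (hconj F ** F) ** diag_real h ** (hconj F ** F)"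
      by (simp only: congr_diag_def matrix_mul_assoc)
    then show ?thesis by (simp add: \<phi>_def unitaryD[OF F] diag_real_nth)
  qed
  ultimately have "(g i has_real_derivative h i) (at 0)"
    by (simp add: has_real_derivative_iff_has_vector_derivative)
  moreover have "g i 0 = 1"
    by (simp add: g_def M_def exp_group_0[OF U] exp_group_0[OF V] unitaryD[OF F]) (simp add: mat_def)
  ultimately show ?thesis by (simp add: DERIV_def)
qed

text \<open>Halving both generators repeatedly only decreases the rescaled distance, by \<open>pd_dist_square\<close>.  At scale
  \<open>1 / 2^k\<close> Klein's inequality bounds it below by \<open>\<parallel>Y - X\<parallel>^p\<close> plus a first order term, and the
  latter tends to 0.\<close>

theorem exp_metric_increasing:
  fixes U V F :: "complex^'n^'n" and x y h :: "'n \<Rightarrow> real"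
  assumes U: "unitary U" and V: "unitary V" and F: "unitary F"
    and H: "congr_diag V y - congr_diag U x = congr_diag F h" and p: "p > 1"
  shows "(\<Sum>i\<in>UNIV. \<bar>h i\<bar> powr p)
    \<le> pd_dist p (congr_diag U (\<lambda>i. exp (x i))) (congr_diag V (\<lambda>i. exp (y i))) powr p"
proof -
  define D where "D t = pd_dist p (exp_group U x t) (exp_group V y t) powr p" for t
  have halving: "(2 ^ k) powr p * D (1 / 2 ^ k) \<le> D 1" for k :: nat
  proof (induction k)
    case (Suc k)
    let ?t = "1 / 2 ^ Suc k :: real"
    have "2 powr p * D ?t \<le> D (?t + ?t)"
      using pd_dist_square(1)[OF exp_group_posdef[OF U] exp_group_posdef[OF V] p, of x ?t y ?t]
      by (simp only: D_def exp_group_add[OF U] exp_group_add[OF V])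
    then have "(2 ^ k) powr p * (2 powr p * D ?t) \<le> (2 ^ k) powr p * D (1 / 2 ^ k)"
      by (intro mult_left_mono) (auto simp: field_simps)
    also have "\<dots> \<le> D 1" by (rule Suc.IH)
    finally show ?case by (simp add: powr_mult mult_ac)
  qed simp
  define M where "M t = exp_group U (\<lambda>i. - 1 / 2 * x i) t ** exp_group V y t
      ** exp_group U (\<lambda>i. - 1 / 2 * x i) t" for t
  define g where "g i t = Re ((hconj F ** M t ** F) $ i $ i)" for i t
  define \<tau> where "\<tau> k = (1 / 2 ^ k :: real)" for k :: nat
  have \<tau>: "\<tau> k > 0" for k by (simp add: \<tau>_def)
  have "\<forall>k. \<exists>c. (\<Sum>i\<in>UNIV. \<bar>h i\<bar> powr p) + (\<Sum>i\<in>UNIV. abs_powr_deriv p (h i) * (c i - h i)) \<le> D 1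
      \<and> (\<forall>i. (1 - g i (- \<tau> k)) / \<tau> k \<le> c i) \<and> (\<forall>i. c i \<le> (g i (\<tau> k) - 1) / \<tau> k)"
  proof
    fix k
    obtain c where c: "(\<Sum>i\<in>UNIV. \<bar>h i\<bar> powr p) + (\<Sum>i\<in>UNIV. abs_powr_deriv p (h i) * (c i - h i))
        \<le> (1 / \<tau> k) powr p * D (\<tau> k)"
      "\<And>i. (1 - g i (- \<tau> k)) / \<tau> k \<le> c i" "\<And>i. c i \<le> (g i (\<tau> k) - 1) / \<tau> k"
      unfolding g_def M_def D_def
      using pd_dist_exp_group_klein[OF U V F p \<tau>[of k], where x = x and y = y and h = h] by blast
    moreover have "(1 / \<tau> k) powr p * D (\<tau> k) \<le> D 1" using halving[of k] by (simp add: \<tau>_def)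
    ultimately show "\<exists>c. (\<Sum>i\<in>UNIV. \<bar>h i\<bar> powr p)
          + (\<Sum>i\<in>UNIV. abs_powr_deriv p (h i) * (c i - h i)) \<le> D 1
        \<and> (\<forall>i. (1 - g i (- \<tau> k)) / \<tau> k \<le> c i) \<and> (\<forall>i. c i \<le> (g i (\<tau> k) - 1) / \<tau> k)"
      by (intro exI[of _ c] conjI allI) (auto intro: order_trans)
  qed
  from choice[OF this] obtain c where c: "\<And>k. (\<Sum>i\<in>UNIV. \<bar>h i\<bar> powr p)
        + (\<Sum>i\<in>UNIV. abs_powr_deriv p (h i) * (c k i - h i)) \<le> D 1"
    and lo: "\<And>k i. (1 - g i (- \<tau> k)) / \<tau> k \<le> c k i"
    and hi: "\<And>k i. c k i \<le> (g i (\<tau> k) - 1) / \<tau> k" by blast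
  have \<tau>0: "\<tau> \<longlonglongrightarrow> 0"
    using LIMSEQ_realpow_zero[of "1 / 2 :: real"] by (simp add: \<tau>_def[abs_def] power_divide)
  have lim: "((\<lambda>t. (g i t - 1) / t) \<longlongrightarrow> h i) (at 0)" for i
    unfolding g_def M_def by (rule conjugated_exp_groups_derivative[OF U V F H])
  have at0: "filterlim \<tau> (at 0) sequentially" "filterlim (\<lambda>k. - \<tau> k) (at 0) sequentially"
    using \<tau>0 tendsto_minus[OF \<tau>0] less_imp_neq[OF \<tau>, symmetric] by (auto simp: filterlim_at)
  have "(\<lambda>k. c k i) \<longlonglongrightarrow> h i" for i
  proof (rule tendsto_sandwich)
    have "(\<lambda>k. (g i (- \<tau> k) - 1) / (- \<tau> k)) \<longlonglongrightarrow> h i"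
      by (rule filterlim_compose[OF lim at0(2)])
    then show "(\<lambda>k. (1 - g i (- \<tau> k)) / \<tau> k) \<longlonglongrightarrow> h i"
      by (simp add: minus_divide_left)
    show "(\<lambda>k. (g i (\<tau> k) - 1) / \<tau> k) \<longlonglongrightarrow> h i"
      by (rule filterlim_compose[OF lim at0(1)])
  qed (use lo hi in auto)
  then have "(\<lambda>k. (\<Sum>i\<in>UNIV. \<bar>h i\<bar> powr p) + (\<Sum>i\<in>UNIV. abs_powr_deriv p (h i) * (c k i - h i)))
      \<longlonglongrightarrow> (\<Sum>i\<in>UNIV. \<bar>h i\<bar> powr p) + (\<Sum>i\<in>UNIV. abs_powr_deriv p (h i) * (h i - h i))"
    by (intro tendsto_intros)
  then have "(\<Sum>i\<in>UNIV. \<bar>h i\<bar> powr p) + (\<Sum>i\<in>UNIV. abs_powr_deriv p (h i) * (h i - h i)) \<le> D 1"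
    by (rule LIMSEQ_le_const2) (use c in auto)
  then show ?thesis by (simp add: D_def exp_group_def)
qed

text \<open>The first halving already loses a positive amount unless the exponentials commute.\<close>

theorem exp_metric_increasing_strict:
  fixes U V F :: "complex^'n^'n" and x y h :: "'n \<Rightarrow> real"
  assumes U: "unitary U" and V: "unitary V" and F: "unitary F"
    and H: "congr_diag V y - congr_diag U x = congr_diag F h" and p: "p > 1"
    and nc: "\<not> mat_commute (congr_diag U (\<lambda>i. exp (x i))) (congr_diag V (\<lambda>i. exp (y i)))"
  shows "(\<Sum>i\<in>UNIV. \<bar>h i\<bar> powr p)
    < pd_dist p (congr_diag U (\<lambda>i. exp (x i))) (congr_diag V (\<lambda>i. exp (y i))) powr p"
proof -
  define P where "P = congr_diag U (\<lambda>i. exp (x i / 2))"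
  define Q where "Q = congr_diag V (\<lambda>i. exp (y i / 2))"
  have scale: "congr_diag S (\<lambda>i. d i / 2) = (1 / 2) *\<^sub>R congr_diag S d" for S :: "complex^'n^'n" and d
    using congr_diag_scaleR[of S "1 / 2" d] by simp
  have "congr_diag V (\<lambda>i. y i / 2) - congr_diag U (\<lambda>i. x i / 2) = congr_diag F (\<lambda>i. h i / 2)"
    unfolding scale by (simp add: H[symmetric] scaleR_diff_right)
  from exp_metric_increasing[OF U V F this p]
  have "(\<Sum>i\<in>UNIV. \<bar>h i / 2\<bar> powr p) \<le> pd_dist p P Q powr p" by (simp add: P_def Q_def)
  then have "2 powr p * (\<Sum>i\<in>UNIV. \<bar>h i / 2\<bar> powr p) \<le> 2 powr p * pd_dist p P Q powr p"
    by (intro mult_left_mono) auto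
  moreover have "2 powr p * (\<Sum>i\<in>UNIV. \<bar>h i / 2\<bar> powr p) = (\<Sum>i\<in>UNIV. \<bar>h i\<bar> powr p)"
    by (simp add: sum_distrib_left powr_mult[symmetric] abs_divide)
  moreover have sq: "congr_diag U (\<lambda>i. exp (x i)) = P ** P" "congr_diag V (\<lambda>i. exp (y i)) = Q ** Q"
    by (simp_all add: P_def Q_def congr_diag_mult unitaryD U V exp_add[symmetric])
  have "P ** Q \<noteq> Q ** P"
  proof
    assume PQ: "P ** Q = Q ** P"
    have "(P ** P) ** (Q ** Q) = P ** (P ** Q) ** Q" by (simp only: matrix_mul_assoc)
    also have "\<dots> = P ** (Q ** P) ** Q" by (simp only: PQ)
    also have "\<dots> = (P ** Q) ** (P ** Q)" by (simp only: matrix_mul_assoc)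
    also have "\<dots> = (Q ** P) ** (Q ** P)" by (simp only: PQ)
    also have "\<dots> = Q ** (P ** Q) ** P" by (simp only: matrix_mul_assoc)
    also have "\<dots> = Q ** (Q ** P) ** P" by (simp only: PQ)
    also have "\<dots> = (Q ** Q) ** (P ** P)" by (simp only: matrix_mul_assoc)
    finally show False using nc by (simp add: sq mat_commute_def)
  qed
  then have "2 powr p * pd_dist p P Q powr p < pd_dist p (P ** P) (Q ** Q) powr p"
    by (intro pd_dist_square(2) p)
      (auto simp: P_def Q_def intro!: posdef_congr_diag unitary_invertible U V)
  ultimately show ?thesis unfolding sq by linarith
qed

section \<open>Clarkson's inequality for Hermitian matrices\<close>

lemma powr_ge_tangent_at_1:
  fixes t r :: real
  assumes "t \<ge> 0" "r \<ge> 1"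
  shows "t powr r \<ge> 1 + r * (t - 1)"
proof (cases "t = 0 \<or> t = 1 \<or> r = 1")
  case False
  then show ?thesis using powr_gt_tangent_at_1[of t r] assms by simp
qed (use assms in auto)

text \<open>Jensen's inequality for the convex power, which vanishes at 0, allows total weight below 1.\<close>

lemma subprob_powr_sum_le:
  fixes \<alpha> t :: "'a \<Rightarrow> real"
  assumes fin: "finite A" and \<alpha>: "\<And>k. k \<in> A \<Longrightarrow> \<alpha> k \<ge> 0" and sub: "(\<Sum>k\<in>A. \<alpha> k) \<le> 1"
    and t: "\<And>k. k \<in> A \<Longrightarrow> t k \<ge> 0" and r: "r \<ge> 1"
  shows "(\<Sum>k\<in>A. \<alpha> k * t k) powr r \<le> (\<Sum>k\<in>A. \<alpha> k * t k powr r)"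
proof -
  define m where "m = (\<Sum>k\<in>A. \<alpha> k * t k)"
  define w where "w = (\<Sum>k\<in>A. \<alpha> k)"
  have m0: "m \<ge> 0" unfolding m_def using \<alpha> t by (intro sum_nonneg) auto
  show ?thesis
  proof (cases "m = 0")
    case True
    have "(\<Sum>k\<in>A. \<alpha> k * t k powr r) \<ge> 0" using \<alpha> by (intro sum_nonneg) auto
    then show ?thesis using True r by (simp add: m_def)
  next
    case False
    then have m: "m > 0" using m0 by simp
    have "m powr r * (1 + r * (t k / m - 1)) \<le> t k powr r" if "k \<in> A" for k
    proof -
      have "m powr r * (1 + r * (t k / m - 1)) \<le> m powr r * (t k / m) powr r"
        using powr_ge_tangent_at_1[of "t k / m" r] t[OF that] m r by (intro mult_left_mono) auto
      also have "\<dots> = t k powr r" using m t[OF that] by (simp add: powr_divide)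
      finally show ?thesis .
    qed
    then have "(\<Sum>k\<in>A. \<alpha> k * (m powr r * (1 + r * (t k / m - 1)))) \<le> (\<Sum>k\<in>A. \<alpha> k * t k powr r)"
      using \<alpha> by (intro sum_mono mult_left_mono) auto
    moreover have "(\<Sum>k\<in>A. \<alpha> k * (m powr r * (1 + r * (t k / m - 1))))
        = m powr r * (w * (1 - r) + r * (m / m))"
    proof -
      have "(\<Sum>k\<in>A. \<alpha> k * (m powr r * (1 + r * (t k / m - 1))))
          = (\<Sum>k\<in>A. m powr r * (\<alpha> k * (1 - r) + r * (\<alpha> k * t k / m)))"
        by (intro sum.cong) (auto simp: algebra_simps)
      also have "\<dots> = m powr r * ((\<Sum>k\<in>A. \<alpha> k * (1 - r)) + (\<Sum>k\<in>A. r * (\<alpha> k * t k / m)))"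
        by (simp only: sum_distrib_left[symmetric] sum.distrib)
      also have "(\<Sum>k\<in>A. \<alpha> k * (1 - r)) = w * (1 - r)" by (simp add: w_def sum_distrib_right)
      also have "(\<Sum>k\<in>A. r * (\<alpha> k * t k / m)) = r * (m / m)"
        by (subst (2) m_def) (simp add: sum_distrib_left sum_divide_distrib)
      finally show ?thesis .
    qed
    moreover have "m powr r * 1 \<le> m powr r * (w * (1 - r) + r * (m / m))"
    proof (rule mult_left_mono)
      have "(1 - w) * (r - 1) \<ge> 0" using sub r by (simp add: w_def)
      then show "1 \<le> w * (1 - r) + r * (m / m)" using m by (simp add: algebra_simps)
    qed simp
    ultimately show ?thesis by (simp add: m_def)
  qed
qed

lemma powr_mean_le:
  fixes a b r :: real
  assumes "a \<ge> 0" "b \<ge> 0" "r \<ge> 1"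
  shows "2 * ((a + b) / 2) powr r \<le> a powr r + b powr r"
proof -
  have "(\<Sum>k\<in>{True, False}. (1 / 2) * (if k then a else b)) powr r
      \<le> (\<Sum>k\<in>{True, False}. (1 / 2) * (if k then a else b) powr r)"
    using assms by (intro subprob_powr_sum_le) auto
  then show ?thesis by (simp add: add_divide_distrib)
qed

lemma square_diag_form:
  fixes U F :: "complex^'n^'n"
  assumes U: "unitary U" and X: "X = congr_diag U x"
  shows "Re ((hconj F ** (X ** X) ** F) $ j $ j)
    = (\<Sum>i\<in>UNIV. (cmod ((hconj U ** F) $ i $ j))\<^sup>2 * (x i)\<^sup>2)"
  using quadratic_form_diag[of "hconj U ** F" "\<lambda>i. (x i)\<^sup>2" j]
  unfolding X congr_diag_mult[OF unitaryD(1)[OF U]]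
  by (simp add: congr_diag_def hconj_mult matrix_mul_assoc power2_eq_square)

text \<open>The squared length of the image of a basis vector is an average of squared eigenvalues, so Jensen's
  inequality for the power \<open>p / 2\<close> applies vector by vector; summed up, the averages have unit weights.\<close>

lemma image_length_power_sum_le:
  fixes U F :: "complex^'n^'n"
  assumes U: "unitary U" and F: "unitary F" and p: "p \<ge> 2"
  shows "(\<Sum>j\<in>UNIV. Re ((hconj F ** (congr_diag U x ** congr_diag U x) ** F) $ j $ j) powr (p / 2))
    \<le> (\<Sum>i\<in>UNIV. \<bar>x i\<bar> powr p)"
proof -
  let ?q = "\<lambda>i j. (cmod ((hconj U ** F) $ i $ j))\<^sup>2"
  have UF: "unitary (hconj U ** F)" by (intro unitary_mult unitary_hconj U F)
  have pow: "(t\<^sup>2) powr (p / 2) = \<bar>t\<bar> powr p" for t :: real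
  proof -
    have "t\<^sup>2 = \<bar>t\<bar> powr 2" by simp
    then show ?thesis by (simp only: powr_powr) simp
  qed
  have "(\<Sum>i\<in>UNIV. ?q i j * (x i)\<^sup>2) powr (p / 2) \<le> (\<Sum>i\<in>UNIV. ?q i j * \<bar>x i\<bar> powr p)" for j
    using subprob_powr_sum_le[of UNIV "\<lambda>i. ?q i j" "\<lambda>i. (x i)\<^sup>2" "p / 2"]
      unitary_column_sum[OF unitaryD(1)[OF UF], of j] p by (simp add: pow)
  then have "(\<Sum>j\<in>UNIV. (\<Sum>i\<in>UNIV. ?q i j * (x i)\<^sup>2) powr (p / 2))
      \<le> (\<Sum>j\<in>UNIV. \<Sum>i\<in>UNIV. ?q i j * \<bar>x i\<bar> powr p)"
    by (intro sum_mono)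
  also have "\<dots> = (\<Sum>i\<in>UNIV. \<bar>x i\<bar> powr p)"
    by (subst sum.swap) (simp add: sum_distrib_right[symmetric] unitary_row_sum[OF UF])
  finally show ?thesis by (simp add: square_diag_form[OF U refl])
qed

text \<open>McCarthy's superadditivity of \<open>Tr S^r\<close>, \<open>r = p / 2\<close>, on positive semidefinite matrices.  The
  squared eigenvalues of \<open>X\<close> and \<open>Y\<close> are subconvex combinations of those of
  \<open>S = X ** X + Y ** Y\<close>, with weights \<open>x i ^ 2 * |w k . u i|^2 / s k\<close> which for each
  \<open>k\<close> with \<open>s k \<noteq> 0\<close> add up to 1 over both families.  Hence the right hand sides obtained for \<open>X\<close>
  and for \<open>Y\<close> add up to \<open>Tr S^r\<close>.  Where \<open>s k = 0\<close> the weights are 0, by division by zero.\<close>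

lemma mccarthy_weights:
  fixes U W X Z :: "complex^'n^'n"
  assumes U: "unitary U" and W: "unitary W" and X: "X = congr_diag U x"
    and Z: "hconj Z = Z" and S: "X ** X + Z ** Z = congr_diag W s" and p: "p \<ge> 2"
  shows "(\<Sum>i\<in>UNIV. \<bar>x i\<bar> powr p)
    \<le> (\<Sum>k\<in>UNIV. Re ((hconj W ** (X ** X) ** W) $ k $ k) / s k * s k powr (p / 2))"
proof -
  let ?q = "\<lambda>i k. (cmod ((hconj U ** W) $ i $ k))\<^sup>2"
  define \<alpha> where "\<alpha> i k = (x i)\<^sup>2 * ?q i k / s k" for i k
  have UW: "unitary (hconj U ** W)" by (intro unitary_mult unitary_hconj U W)
  have nonneg: "Re ((hconj F ** (Z ** Z) ** F) $ k $ k) \<ge> 0" for F k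
  proof -
    have "hconj F ** (Z ** Z) ** F = hconj (Z ** F) ** diag_real (\<lambda>i. 1) ** (Z ** F)"
      by (simp add: hconj_mult Z diag_real_one matrix_mul_assoc)
    then have "Re ((hconj F ** (Z ** Z) ** F) $ k $ k) = (\<Sum>m\<in>UNIV. (cmod ((Z ** F) $ m $ k))\<^sup>2 * 1)"
      by (simp only: quadratic_form_diag)
    then show ?thesis by (simp add: sum_nonneg)
  qed
  have s_eq: "s k = (\<Sum>i\<in>UNIV. ?q i k * (x i)\<^sup>2) + Re ((hconj W ** (Z ** Z) ** W) $ k $ k)" for k
  proof -
    have "hconj W ** (X ** X + Z ** Z) ** W = (hconj W ** W) ** diag_real s ** (hconj W ** W)"
      unfolding S congr_diag_def by (simp only: matrix_mul_assoc)
    then have "hconj W ** (X ** X) ** W + hconj W ** (Z ** Z) ** W = diag_real s"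
      by (simp add: unitaryD[OF W] matrix_distribs)
    then have "Re ((hconj W ** (X ** X) ** W) $ k $ k) + Re ((hconj W ** (Z ** Z) ** W) $ k $ k) = s k"
      by (metis Re_complex_of_real diag_real_nth plus_complex.sel(1) vector_add_component)
    then show ?thesis by (simp add: square_diag_form[OF U X])
  qed
  have s_ge: "?q i k * (x i)\<^sup>2 \<le> s k" for i k
  proof -
    have "?q i k * (x i)\<^sup>2 \<le> (\<Sum>i\<in>UNIV. ?q i k * (x i)\<^sup>2)"
      by (rule member_le_sum) auto
    then show ?thesis using s_eq[of k] nonneg[of W k] by linarith
  qed
  have s0: "s k \<ge> 0" for k using s_ge[of undefined k] by (rule order_trans[rotated]) simp
  have \<alpha>0: "\<alpha> i k \<ge> 0" for i k by (simp add: \<alpha>_def s0)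
  have mean: "(\<Sum>k\<in>UNIV. \<alpha> i k * s k) = (x i)\<^sup>2" for i
  proof -
    have "\<alpha> i k * s k = (x i)\<^sup>2 * ?q i k" for k
      using s_ge[of i k] by (cases "s k = 0") (auto simp: \<alpha>_def mult_le_0_iff)
    then show ?thesis by (simp add: sum_distrib_left[symmetric] unitary_row_sum[OF UW])
  qed
  \<comment> \<open>With \<open>G\<close> the pseudoinverse of \<open>S\<close>, this is \<open>x i ^ 2 * (u i . G u i) \<le> 1\<close>: test
    \<open>X ** X \<le> S\<close> on the vector \<open>G u i\<close>.\<close>
  have sub: "(\<Sum>k\<in>UNIV. \<alpha> i k) \<le> 1" for i
  proof -
    define G where "G = congr_diag W (\<lambda>k. inverse (s k))"
    define \<tau> where "\<tau> = (\<Sum>k\<in>UNIV. ?q i k * inverse (s k))"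
    have WG: "hconj U ** congr_diag W d ** U = hconj (hconj W ** U) ** diag_real d ** (hconj W ** U)" for d
      by (simp add: congr_diag_def hconj_mult matrix_mul_assoc)
    have sym: "cmod ((hconj W ** U) $ k $ i) = cmod ((hconj U ** W) $ i $ k)" for k
      by (metis complex_mod_cnj hconj_hconj hconj_mult hconj_nth)
    have quadU: "Re ((hconj U ** congr_diag W d ** U) $ i $ i) = (\<Sum>k\<in>UNIV. ?q i k * d k)" for d
      unfolding WG quadratic_form_diag by (simp add: sym)
    have "G ** (X ** X + Z ** Z) ** G = G"
      unfolding S G_def congr_diag_mult[OF unitaryD(1)[OF W]]
      by (rule arg_cong[where f = "congr_diag W"]) (auto simp: fun_eq_iff field_simps)
    then have "hconj U ** G ** U = hconj (G ** U) ** (X ** X) ** (G ** U) + hconj (G ** U) ** (Z ** Z) ** (G ** U)"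
    proof -
      assume a: "G ** (X ** X + Z ** Z) ** G = G"
      have "hconj G = G" by (simp add: G_def congr_diag_hermitian)
      then have "hconj (G ** U) ** (X ** X) ** (G ** U) + hconj (G ** U) ** (Z ** Z) ** (G ** U)
          = hconj U ** (G ** (X ** X + Z ** Z) ** G) ** U"
        by (simp add: hconj_mult matrix_distribs matrix_mul_assoc)
      then show ?thesis by (simp add: a)
    qed
    then have "\<tau> = Re ((hconj (G ** U) ** (X ** X) ** (G ** U)) $ i $ i)
        + Re ((hconj (G ** U) ** (Z ** Z) ** (G ** U)) $ i $ i)"
      unfolding \<tau>_def quadU[symmetric] G_def[symmetric] by simp
    then have "Re ((hconj (G ** U) ** (X ** X) ** (G ** U)) $ i $ i) \<le> \<tau>"
      using nonneg[of "G ** U" i] by linarith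
    moreover have "(cmod ((hconj U ** (G ** U)) $ i $ i))\<^sup>2 * (x i)\<^sup>2
        \<le> Re ((hconj (G ** U) ** (X ** X) ** (G ** U)) $ i $ i)"
      unfolding square_diag_form[OF U X]
      by (rule member_le_sum[where f = "\<lambda>l. (cmod ((hconj U ** (G ** U)) $ l $ i))\<^sup>2 * (x l)\<^sup>2"]) auto
    moreover have "\<bar>Re ((hconj U ** G ** U) $ i $ i)\<bar> \<le> cmod ((hconj U ** G ** U) $ i $ i)"
      by (rule abs_Re_le_cmod)
    then have "\<tau>\<^sup>2 \<le> (cmod ((hconj U ** (G ** U)) $ i $ i))\<^sup>2"
      unfolding \<tau>_def quadU[symmetric] G_def[symmetric] matrix_mul_assoc
      by (metis abs_ge_zero power2_abs power_mono)
    then have "\<tau>\<^sup>2 * (x i)\<^sup>2 \<le> (cmod ((hconj U ** (G ** U)) $ i $ i))\<^sup>2 * (x i)\<^sup>2"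
      by (rule mult_right_mono) simp
    ultimately have "\<tau> * (\<tau> * (x i)\<^sup>2) \<le> \<tau> * 1" by (simp add: power2_eq_square mult_ac)
    moreover have "\<tau> \<ge> 0" by (simp add: \<tau>_def sum_nonneg s0)
    ultimately have "\<tau> * (x i)\<^sup>2 \<le> 1" by (cases "\<tau> = 0") auto
    moreover have "(\<Sum>k\<in>UNIV. \<alpha> i k) = \<tau> * (x i)\<^sup>2"
      unfolding \<alpha>_def \<tau>_def sum_distrib_right by (simp add: divide_inverse mult_ac)
    ultimately show ?thesis by simp
  qed
  have pow: "((x i)\<^sup>2) powr (p / 2) = \<bar>x i\<bar> powr p" for i
  proof -
    have "(x i)\<^sup>2 = \<bar>x i\<bar> powr 2" by simp
    then show ?thesis by (simp only: powr_powr) simp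
  qed
  have "\<bar>x i\<bar> powr p \<le> (\<Sum>k\<in>UNIV. \<alpha> i k * s k powr (p / 2))" for i
    using subprob_powr_sum_le[of UNIV "\<alpha> i" s "p / 2"] \<alpha>0 sub s0 p by (simp add: mean pow)
  then have "(\<Sum>i\<in>UNIV. \<bar>x i\<bar> powr p) \<le> (\<Sum>i\<in>UNIV. \<Sum>k\<in>UNIV. \<alpha> i k * s k powr (p / 2))"
    by (intro sum_mono)
  also have "\<dots> = (\<Sum>k\<in>UNIV. (\<Sum>i\<in>UNIV. \<alpha> i k) * s k powr (p / 2))"
    by (subst sum.swap) (simp add: sum_distrib_right)
  also have "\<dots> = (\<Sum>k\<in>UNIV. Re ((hconj W ** (X ** X) ** W) $ k $ k) / s k * s k powr (p / 2))"
    unfolding square_diag_form[OF U X] \<alpha>_def by (simp add: sum_divide_distrib mult_ac)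
  finally show ?thesis .
qed

text \<open>The parallelogram law \<open>(X + Y)^2 + (X - Y)^2 = 2 S\<close>, \<open>S = X^2 + Y^2\<close>, holds as an identity of
  matrices.  In an eigenbasis of \<open>S\<close>, convexity of the power \<open>p / 2\<close> bounds the left hand side
  below by \<open>2 Tr S^(p/2)\<close>, and superadditivity of \<open>Tr S^(p/2)\<close> finishes.\<close>

theorem clarkson_hermitian:
  fixes U V F F' :: "complex^'n^'n"
  assumes U: "unitary U" and V: "unitary V" and F: "unitary F" and F': "unitary F'"
    and sum: "congr_diag U x + congr_diag V y = congr_diag F a"
    and diff: "congr_diag U x - congr_diag V y = congr_diag F' b" and p: "p \<ge> 2"
  shows "2 * ((\<Sum>i\<in>UNIV. \<bar>x i\<bar> powr p) + (\<Sum>i\<in>UNIV. \<bar>y i\<bar> powr p))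
    \<le> (\<Sum>i\<in>UNIV. \<bar>a i\<bar> powr p) + (\<Sum>i\<in>UNIV. \<bar>b i\<bar> powr p)"
proof -
  define X where "X = congr_diag U x"
  define Y where "Y = congr_diag V y"
  have herm: "hconj X = X" "hconj Y = Y" by (simp_all add: X_def Y_def congr_diag_hermitian)
  have "hermitian (X ** X + Y ** Y)" by (simp add: hermitian_def hconj_add hconj_mult herm)
  then obtain W s where W: "unitary W" and S: "X ** X + Y ** Y = congr_diag W s"
    using spectral_theorem by blast
  define \<xi> where "\<xi> k = Re ((hconj W ** (X ** X) ** W) $ k $ k)" for k
  define \<eta> where "\<eta> k = Re ((hconj W ** (Y ** Y) ** W) $ k $ k)" for k
  have entry: "Re ((hconj W ** (A ** A) ** W) $ k $ k) + Re ((hconj W ** (B ** B) ** W) $ k $ k)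
      = Re ((hconj W ** (A ** A + B ** B) ** W) $ k $ k)" for A B k
    by (simp add: matrix_distribs)
  have s: "\<xi> k + \<eta> k = s k" for k
  proof -
    have "hconj W ** congr_diag W s ** W = (hconj W ** W) ** diag_real s ** (hconj W ** W)"
      unfolding congr_diag_def by (simp only: matrix_mul_assoc)
    then have "hconj W ** (X ** X + Y ** Y) ** W = diag_real s"
      by (simp add: S unitaryD[OF W])
    then show ?thesis unfolding \<xi>_def \<eta>_def entry by (simp add: diag_real_nth)
  qed
  have nonneg: "\<xi> k \<ge> 0" "\<eta> k \<ge> 0" for k
    unfolding \<xi>_def \<eta>_def square_diag_form[OF U X_def] square_diag_form[OF V Y_def]
    by (auto intro!: sum_nonneg)
  define \<alpha> where "\<alpha> k = Re ((hconj W ** ((X + Y) ** (X + Y)) ** W) $ k $ k)" for k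
  define \<beta> where "\<beta> k = Re ((hconj W ** ((X - Y) ** (X - Y)) ** W) $ k $ k)" for k
  have "(X + Y) ** (X + Y) + (X - Y) ** (X - Y) = (X ** X + Y ** Y) + (X ** X + Y ** Y)"
    by (simp add: matrix_distribs)
  then have para: "\<alpha> k + \<beta> k = 2 * s k" for k
    unfolding \<alpha>_def \<beta>_def entry s[symmetric] \<xi>_def \<eta>_def
    by (simp only: matrix_add_ldistrib matrix_add_rdistrib vector_add_component plus_complex.sel)
      simp
  have eqs: "X + Y = congr_diag F a" "X - Y = congr_diag F' b"
    using sum diff by (simp_all add: X_def Y_def)
  have \<alpha>\<beta>0: "\<alpha> k \<ge> 0" "\<beta> k \<ge> 0" for k
    unfolding \<alpha>_def \<beta>_def square_diag_form[OF F eqs(1)] square_diag_form[OF F' eqs(2)]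
    by (auto intro!: sum_nonneg)
  have "(\<Sum>i\<in>UNIV. \<bar>x i\<bar> powr p) \<le> (\<Sum>k\<in>UNIV. \<xi> k / s k * s k powr (p / 2))"
    unfolding \<xi>_def by (rule mccarthy_weights[OF U W X_def herm(2) S p])
  moreover have "(\<Sum>i\<in>UNIV. \<bar>y i\<bar> powr p) \<le> (\<Sum>k\<in>UNIV. \<eta> k / s k * s k powr (p / 2))"
    unfolding \<eta>_def by (rule mccarthy_weights[OF V W Y_def herm(1) _ p]) (simp add: S[symmetric] add.commute)
  moreover have "(\<Sum>k\<in>UNIV. \<xi> k / s k * s k powr (p / 2)) + (\<Sum>k\<in>UNIV. \<eta> k / s k * s k powr (p / 2))
      = (\<Sum>k\<in>UNIV. s k powr (p / 2))"
  proof -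
    have "\<xi> k / s k * s k powr (p / 2) + \<eta> k / s k * s k powr (p / 2) = s k powr (p / 2)" for k
      using s[of k] by (cases "s k = 0") (auto simp: distrib_right[symmetric] add_divide_distrib[symmetric])
    then show ?thesis by (simp only: sum.distrib[symmetric])
  qed
  ultimately have "(\<Sum>i\<in>UNIV. \<bar>x i\<bar> powr p) + (\<Sum>i\<in>UNIV. \<bar>y i\<bar> powr p) \<le> (\<Sum>k\<in>UNIV. s k powr (p / 2))"
    by linarith
  then have "2 * ((\<Sum>i\<in>UNIV. \<bar>x i\<bar> powr p) + (\<Sum>i\<in>UNIV. \<bar>y i\<bar> powr p))
      \<le> (\<Sum>k\<in>UNIV. 2 * ((\<alpha> k + \<beta> k) / 2) powr (p / 2))"
    by (simp add: para sum_distrib_left[symmetric])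
  also have "\<dots> \<le> (\<Sum>k\<in>UNIV. \<alpha> k powr (p / 2) + \<beta> k powr (p / 2))"
    using p by (intro sum_mono powr_mean_le \<alpha>\<beta>0) auto
  also have "\<dots> \<le> (\<Sum>i\<in>UNIV. \<bar>a i\<bar> powr p) + (\<Sum>i\<in>UNIV. \<bar>b i\<bar> powr p)"
    unfolding sum.distrib \<alpha>_def \<beta>_def eqs
    by (intro add_mono image_length_power_sum_le F F' W p)
  finally show ?thesis .
qed

section \<open>The semi-parallelogram inequality\<close>

text \<open>Congruence by the inverse of a square root of the geometric mean moves \<open>A\<close>, \<open>B\<close> to
  \<open>exp (- X)\<close>, \<open>exp X\<close> with midpoint \<open>mat 1\<close>, and \<open>C\<close> to \<open>exp Y\<close>.  The exponential metric increasing
  property replaces the distances to \<open>exp Y\<close> by \<open>\<parallel>Y + X\<parallel>\<close> and \<open>\<parallel>Y - X\<parallel>\<close>, and Clarkson's inequality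
  applies.  It is strict at the first step unless \<open>exp (- X)\<close> and \<open>exp Y\<close> commute.\<close>

theorem semi_parallelogram:
  fixes A B C :: "complex^'n^'n"
  assumes A: "A \<in> posdef" and B: "B \<in> posdef" and C: "C \<in> posdef" and p: "p \<ge> 2"
  defines "lhs \<equiv> (pd_dist p A C powr p + pd_dist p B C powr p) / 2"
    and "rhs \<equiv> 2 powr (- p) * pd_dist p A B powr p + pd_dist p (geom_mean A B) C powr p"
  shows "rhs \<le> lhs" and "\<not> Gamma_commute A B C \<Longrightarrow> rhs < lhs"
proof -
  have p0: "p > 0" "p > 1" using p by auto
  obtain R z where R: "invertible R" and AR: "A = R ** hconj R"
    and BR: "B = congr_diag R (\<lambda>i. exp (z i))"
    using posdef_simultaneous_diag[OF A B] .
  define x where "x i = z i / 2" for i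
  define S where "S = R ** diag_real (\<lambda>i. exp (z i / 4))"
  have "diag_real (\<lambda>i. exp (z i / 4)) ** diag_real (\<lambda>i. exp (- z i / 4)) = mat 1"
    by (simp add: diag_real_mult exp_add[symmetric] diag_real_one)
  then have "invertible (diag_real (\<lambda>i. exp (z i / 4)))"
    by (metis invertible_right_inverse)
  then have S: "invertible S" by (simp add: S_def invertible_mult R)
  have exp4: "(exp (z i / 4))\<^sup>2 = exp (z i / 2)" for i
    by (simp add: exp_double[symmetric])
  have AS: "A = congr_diag S (\<lambda>i. exp (- x i))"
    by (simp add: AR S_def congr_diag_scale exp4 x_def exp_add[symmetric] congr_diag_one)
  have BS: "B = congr_diag S (\<lambda>i. exp (x i))"
    by (simp add: BR S_def congr_diag_scale exp4 x_def exp_add[symmetric])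
  have GS: "geom_mean A B = S ** hconj S"
    unfolding AR BR geom_mean_congr_diag[OF R] congr_diag_one[of S, symmetric]
    by (simp add: S_def congr_diag_scale exp4)
  obtain S' where S': "S ** S' = mat 1" "S' ** S = mat 1" using S by (auto simp: invertible_def)
  then have invS': "invertible S'" by (auto simp: invertible_def)
  have uncongr: "S ** (S' ** D ** hconj S') ** hconj S = D" for D
  proof -
    have "S ** (S' ** D ** hconj S') ** hconj S = (S ** S') ** D ** hconj (S ** S')"
      by (simp add: hconj_mult matrix_mul_assoc)
    then show ?thesis by (simp add: S')
  qed
  have congr: "S' ** congr_diag S d ** hconj S' = congr_diag (mat 1) d" for d
    by (simp add: congr_diag_congr S')
  obtain V y where V: "unitary V" and CV: "S' ** C ** hconj S' = congr_diag V (\<lambda>i. exp (y i))"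
    using posdef_spectral[OF posdef_congruence[OF invS' C]] .
  have I: "unitary (mat 1 :: complex^'n^'n)" by (simp add: unitary_def)
  have CS: "C = S ** congr_diag V (\<lambda>i. exp (y i)) ** hconj S" using uncongr[of C] by (simp add: CV)
  have AB: "2 powr (- p) * pd_dist p A B powr p = (\<Sum>i\<in>UNIV. \<bar>x i\<bar> powr p)"
  proof -
    have "\<bar>z i\<bar> powr p = 2 powr p * \<bar>x i\<bar> powr p" for i
      by (simp add: x_def powr_mult[symmetric] abs_divide)
    then have "pd_dist p A B powr p = 2 powr p * (\<Sum>i\<in>UNIV. \<bar>x i\<bar> powr p)"
      unfolding AR BR pd_dist_congr_diag[OF R p0(1)] by (simp add: sum_distrib_left)
    then show ?thesis by (simp add: powr_minus)
  qed
  have GC: "pd_dist p (geom_mean A B) C powr p = (\<Sum>i\<in>UNIV. \<bar>y i\<bar> powr p)"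
  proof -
    have "S ** hconj S = (S ** V) ** hconj (S ** V)"
      by (simp add: hconj_mult matrix_mult_cancel_mid unitaryD[OF V])
    moreover have "C = congr_diag (S ** V) (\<lambda>i. exp (y i))" by (simp add: CS congr_diag_congr)
    ultimately show ?thesis
      using pd_dist_congr_diag[OF invertible_mult[OF S unitary_invertible[OF V]] p0(1)]
      by (simp add: GS)
  qed
  have dist: "pd_dist p (congr_diag S (\<lambda>i. exp (d i))) C powr p
      = pd_dist p (congr_diag (mat 1) (\<lambda>i. exp (d i))) (congr_diag V (\<lambda>i. exp (y i))) powr p" for d
    unfolding CS
    using pd_dist_congruence[OF posdef_congr_diag[OF unitary_invertible[OF I]]
        posdef_congr_diag[OF unitary_invertible[OF V]] S p0(1),
        of "\<lambda>i. exp (d i)" "\<lambda>i. exp (y i)"]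
    by (simp add: congr_diag_congr)
  have hermV: "hermitian (congr_diag V y + congr_diag (mat 1) x)"
      "hermitian (congr_diag V y - congr_diag (mat 1) x)"
    by (simp_all add: hermitian_def hconj_add hconj_diff congr_diag_hermitian)
  obtain F a where F: "unitary F" and sum: "congr_diag V y + congr_diag (mat 1) x = congr_diag F a"
    using spectral_theorem[OF hermV(1)] .
  obtain F' b where F': "unitary F'" and diff: "congr_diag V y - congr_diag (mat 1) x = congr_diag F' b"
    using spectral_theorem[OF hermV(2)] .
  have sum': "congr_diag V y - congr_diag (mat 1) (\<lambda>i. - x i) = congr_diag F a"
    using sum congr_diag_scaleR[of "mat 1" "-1" x] by simp
  have clarkson: "rhs \<le> ((\<Sum>i\<in>UNIV. \<bar>a i\<bar> powr p) + (\<Sum>i\<in>UNIV. \<bar>b i\<bar> powr p)) / 2"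
    using clarkson_hermitian[OF V I F F' sum diff p] by (simp add: rhs_def AB GC)
  have distB: "(\<Sum>i\<in>UNIV. \<bar>b i\<bar> powr p) \<le> pd_dist p B C powr p"
    unfolding BS dist by (rule exp_metric_increasing[OF I V F' diff p0(2)])
  have distA: "(\<Sum>i\<in>UNIV. \<bar>a i\<bar> powr p) \<le> pd_dist p A C powr p"
    unfolding AS dist by (rule exp_metric_increasing[OF I V F sum' p0(2)])
  show "rhs \<le> lhs" using clarkson distA distB by (simp add: lhs_def)
  assume ng: "\<not> Gamma_commute A B C"
  define D where "D = congr_diag (mat 1 :: complex^'n^'n) (\<lambda>i. exp (- x i))"
  define D' where "D' = congr_diag (mat 1 :: complex^'n^'n) (\<lambda>i. exp (x i))"
  define C' where "C' = congr_diag V (\<lambda>i. exp (y i))"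
  have DD': "D ** D' = mat 1" "D' ** D = mat 1"
    unfolding D_def D'_def congr_diag_mult[OF unitaryD(1)[OF I]]
    by (simp_all add: exp_add[symmetric] congr_diag_unitary_one[OF I])
  have "\<not> mat_commute D C'"
  proof
    assume "mat_commute D C'"
    then have DC: "D ** C' = C' ** D" by (simp add: mat_commute_def)
    have "D' ** C' = D' ** C' ** (D ** D')" by (simp add: DD')
    also have "\<dots> = D' ** (C' ** D) ** D'" by (simp only: matrix_mul_assoc)
    also have "\<dots> = D' ** (D ** C') ** D'" by (simp only: DC)
    also have "\<dots> = (D' ** D) ** C' ** D'" by (simp only: matrix_mul_assoc)
    finally have D'C: "D' ** C' = C' ** D'" by (simp add: DD')
    have "Gamma_commute A B C"
      unfolding Gamma_commute_def
    proof (intro exI conjI)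
      show "mat_commute (S' ** A ** hconj S') (S' ** B ** hconj S')"
        unfolding AS BS congr D_def[symmetric] D'_def[symmetric] mat_commute_def by (simp add: DD')
      show "mat_commute (S' ** A ** hconj S') (S' ** C ** hconj S')"
        unfolding AS CV congr D_def[symmetric] C'_def[symmetric] mat_commute_def by (rule DC)
      show "mat_commute (S' ** B ** hconj S') (S' ** C ** hconj S')"
        unfolding BS CV congr D'_def[symmetric] C'_def[symmetric] mat_commute_def by (rule D'C)
    qed (rule invS')
    with ng show False by blast
  qed
  then have "(\<Sum>i\<in>UNIV. \<bar>a i\<bar> powr p) < pd_dist p A C powr p"
    unfolding AS dist D_def C'_def by (rule exp_metric_increasing_strict[OF I V F sum' p0(2)])
  then show "rhs < lhs" using clarkson distB by (simp add: lhs_def)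
qed

text \<open>After the congruence by \<open>X\<close>, the product \<open>A ** B\<close> reads \<open>A' N B'\<close> with \<open>N\<close> the inverse of the image
  \<open>X ** hconj X\<close> of the identity; as that image commutes with \<open>A'\<close> and \<open>B'\<close>, so does \<open>N\<close>.\<close>

lemma Gamma_commute_mat_1_imp_commute:
  fixes A B :: "complex^'n^'n"
  assumes "Gamma_commute A B (mat 1)"
  shows "mat_commute A B"
proof -
  obtain X :: "complex^'n^'n" where X: "invertible X"
    and AB: "(X ** A ** hconj X) ** (X ** B ** hconj X) = (X ** B ** hconj X) ** (X ** A ** hconj X)"
    and A1: "(X ** A ** hconj X) ** (X ** hconj X) = (X ** hconj X) ** (X ** A ** hconj X)"
    and B1: "(X ** B ** hconj X) ** (X ** hconj X) = (X ** hconj X) ** (X ** B ** hconj X)"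
    using assms unfolding Gamma_commute_def mat_commute_def by auto
  obtain Y where Y: "X ** Y = mat 1" "Y ** X = mat 1" using X by (auto simp: invertible_def)
  define N where "N = hconj Y ** Y"
  define A' where "A' = X ** A ** hconj X"
  define B' where "B' = X ** B ** hconj X"
  have hXY: "hconj X ** hconj Y = mat 1" "hconj Y ** hconj X = mat 1"
    by (simp_all add: hconj_mult[symmetric] Y)
  have N: "X ** hconj X ** N = mat 1" "N ** (X ** hconj X) = mat 1"
    unfolding N_def by (simp_all add: matrix_mult_cancel_mid hXY Y)
  have conj: "Y ** (X ** D ** hconj X) ** hconj Y = D" for D
  proof -
    have "Y ** (X ** D ** hconj X) ** hconj Y = (Y ** X) ** D ** (hconj X ** hconj Y)"
      by (simp only: matrix_mul_assoc)
    then show ?thesis by (simp add: hXY Y)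
  qed
  have comm: "N ** D = D ** N" if "D ** (X ** hconj X) = (X ** hconj X) ** D" for D
  proof -
    have "N ** (D ** (X ** hconj X)) ** N = N ** ((X ** hconj X) ** D) ** N" using that by simp
    then have "N ** D ** (X ** hconj X ** N) = (N ** (X ** hconj X)) ** D ** N"
      by (simp only: matrix_mul_assoc)
    then show ?thesis by (simp add: N)
  qed
  have NA: "N ** A' = A' ** N" and NB: "N ** B' = B' ** N"
    using comm A1 B1 by (simp_all add: A'_def B'_def)
  have "A ** B = (Y ** A' ** hconj Y) ** (Y ** B' ** hconj Y)" by (simp only: A'_def B'_def conj)
  also have "\<dots> = Y ** ((A' ** N) ** B') ** hconj Y" by (simp only: N_def matrix_mul_assoc)
  also have "\<dots> = Y ** (N ** (A' ** B')) ** hconj Y" by (simp only: NA[symmetric] matrix_mul_assoc)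
  also have "A' ** B' = B' ** A'" using AB by (simp only: A'_def B'_def)
  also have "Y ** (N ** (B' ** A')) ** hconj Y = Y ** ((N ** B') ** A') ** hconj Y"
    by (simp only: matrix_mul_assoc)
  also have "\<dots> = Y ** ((B' ** N) ** A') ** hconj Y" by (simp only: NB)
  also have "\<dots> = (Y ** B' ** hconj Y) ** (Y ** A' ** hconj Y)" by (simp only: N_def matrix_mul_assoc)
  also have "\<dots> = B ** A" by (simp only: A'_def B'_def conj)
  finally show ?thesis by (simp add: mat_commute_def)
qed

theorem theorem3p4:
  fixes A B :: "complex^'n^'n" and p :: real
  assumes "A \<in> posdef" and "B \<in> posdef" and "p \<ge> 2"
  shows
    "(\<forall>C\<in>posdef.
        (pd_dist p A C powr p + pd_dist p B C powr p) / 2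
          \<ge> 2 powr (-p) * pd_dist p A B powr p + pd_dist p (geom_mean A B) C powr p)
   \<and> (pd_dist p A (mat 1) powr p + pd_dist p B (mat 1) powr p) / 2
          \<ge> 2 powr (-p) * pd_dist p A B powr p + pd_dist p (geom_mean A B) (mat 1) powr p
   \<and> (A \<in> exp_unit_sphere p \<and> B \<in> exp_unit_sphere p \<longrightarrow>
        1 - pd_dist p (geom_mean A B) (mat 1) powr p \<ge> 2 powr (-p) * pd_dist p A B powr p)
   \<and> (\<forall>C\<in>posdef. \<not> Gamma_commute A B C \<longrightarrow>
        (pd_dist p A C powr p + pd_dist p B C powr p) / 2
          > 2 powr (-p) * pd_dist p A B powr p + pd_dist p (geom_mean A B) C powr p)
   \<and> (\<not> mat_commute A B \<longrightarrow>
        (pd_dist p A (mat 1) powr p + pd_dist p B (mat 1) powr p) / 2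
          > 2 powr (-p) * pd_dist p A B powr p + pd_dist p (geom_mean A B) (mat 1) powr p)
   \<and> (A \<in> exp_unit_sphere p \<and> B \<in> exp_unit_sphere p \<and> \<not> mat_commute A B \<longrightarrow>
        1 - pd_dist p (geom_mean A B) (mat 1) powr p > 2 powr (-p) * pd_dist p A B powr p)"
proof -
  note semi = semi_parallelogram(1)[OF assms(1,2) _ assms(3)]
    and strict = semi_parallelogram(2)[OF assms(1,2) _ assms(3)]
  have strict1: "\<not> mat_commute A B \<Longrightarrow>
      2 powr (- p) * pd_dist p A B powr p + pd_dist p (geom_mean A B) (mat 1) powr p
      < (pd_dist p A (mat 1) powr p + pd_dist p B (mat 1) powr p) / 2"
    using strict[OF posdef_mat_1] Gamma_commute_mat_1_imp_commute by blast
  have sphere: "(pd_dist p A (mat 1) powr p + pd_dist p B (mat 1) powr p) / 2 = 1"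
    if "A \<in> exp_unit_sphere p \<and> B \<in> exp_unit_sphere p"
    using that by (simp add: exp_unit_sphere_def)
  show ?thesis
  proof (intro conjI ballI impI)
    assume "A \<in> exp_unit_sphere p \<and> B \<in> exp_unit_sphere p"
    from sphere[OF this] semi[OF posdef_mat_1]
    show "2 powr (- p) * pd_dist p A B powr p \<le> 1 - pd_dist p (geom_mean A B) (mat 1) powr p"
      by linarith
  next
    assume *: "A \<in> exp_unit_sphere p \<and> B \<in> exp_unit_sphere p \<and> \<not> mat_commute A B"
    then have "(pd_dist p A (mat 1) powr p + pd_dist p B (mat 1) powr p) / 2 = 1"
      using sphere by blast
    with strict1 * show "2 powr (- p) * pd_dist p A B powr p < 1 - pd_dist p (geom_mean A B) (mat 1) powr p"
      by linarith
  qed (use semi strict semi[OF posdef_mat_1] strict1 in blast)+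
qed

end
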